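(* Let $B\in\mathbb{R}_+^{n\times n}$ be a nonnegative row uniform matrix, with classes $B_1,\dots,B_p$ (the diagonal blocks of its Frobenius normal form), and let $\eta(B)=\{\rho(A): A\in\mathbb{R}_+^{n\times n},\ \operatorname{Aux}(A)=B\}$. Let $M(B)=\max_{\mathcal{G}\in\mathcal{S}(B)}\mu(\mathcal{G})$ and $m(B)=\min_{\mathcal{G}\in\mathcal{S}(B)}\mu(\mathcal{G})$, where $\mathcal{S}(B)$ is the set of sunflower subgraphs of $\mathcal{G}(B)$. (One has $m(B)=\max\{\nu(B_i): B_i \text{ a final class of } B\}$.) Then: (i) $\eta(B)\subseteq[m(B),M(B)]$. (ii) $M(B)\in\eta(B)$ if and only if there is at least one final class $B_i$ with $\mu(B_i)=\nu(B_i)=M(B)$. (iii) If $m(B)>0$, then $m(B)\in\eta(B)$ if and only if $\mu(B_i)=\nu(B_i)=m(B)$ for all final (nontrivial) classes $B_i$ that attain the maximum $\max\{\nu(B_j): B_j\text{ a final class of }B\}$. If $m(B)=0$, then $m(B)\in\eta(B)$ if and only if $\mathcal{G}(B)$ is acyclic, in which case $\eta(B)=\{0\}$. (iv) If $M(B)=m(B)$, then $\eta(B)=\{m(B)\}$. (v) If $M(B)>m(B)$, then the open interval $(m(B),M(B))$ is contained in $\eta(B)$.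
   Context: $\mathbb{R}_+$ denotes the nonnegative reals; $\rho(A)$ is the spectral radius (Perron root) of a nonnegative matrix $A$. For $A=(a_{ij})\in\mathbb{R}_+^{n\times n}$, the auxiliary matrix $\operatorname{Aux}(A)=(b_{ij})$ is defined by $b_{ij}=\sum_k a_{ik}$ if $a_{ij}\neq0$ and $b_{ij}=0$ if $a_{ij}=0$. A nonnegative matrix is row uniform if, in every row, all nonzero entries are equal. The associated weighted digraph $\mathcal{G}(A)$ of $A\in\mathbb{R}_+^{n\times n}$ has node set $\{1,\dots,n\}$ and an edge $(i,j)$ of weight $a_{ij}$ exactly when $a_{ij}\ne0$ (loops allowed). For a weighted digraph, the geometric mean of a cycle $(i_1,\dots,i_\ell)$ is $(a_{i_1i_2}a_{i_2i_3}\cdots a_{i_\ell i_1})^{1/\ell}$. $\mu$ and $\nu$ denote respectively the maximum and minimum cycle geometric mean of a weighted digraph (or of a matrix, through its digraph); both are $0$ if there are no cycles. The classes of $B$ are the principal submatrices $B_i$ of $B$ on the node sets of the maximal strongly connected components of $\mathcal{G}(B)$. A class is trivial if it is a $1\times1$ zero block, and nontrivial otherwise. A class is final if no edge of $\mathcal{G}(B)$ goes from one of its nodes to a node of another component; otherwise it is transient. A sunflower subgraph $\tilde{\mathcal{G}}$ of a weighted digraph $\mathcal{G}$ is a subgraph on the full node set such that each node having an outgoing edge in $\mathcal{G}$ has exactly one outgoing edge in $\tilde{\mathcal{G}}$, and every edge of $\tilde{\mathcal{G}}$ has the same weight as in $\mathcal{G}$. *)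

theory Defs
  imports
    "Graph_Theory.Digraph_Component"
    "Graph_Theory.Weighted_Graph"
    "Jordan_Normal_Form.Spectral_Radius"
    "Jordan_Normal_Form.DL_Submatrix"
begin

text \<open>A matrix of order \<open>n\<close> has index set \<open>{0..<n}\<close>. A weighted digraph is a digraph
  together with a separate weight function on its arcs, so a subgraph whose arcs keep their weights
  is a subgraph used with the same weight function.\<close>

definition nonneg_mats :: "nat \<Rightarrow> real mat set" where
  "nonneg_mats n = {A \<in> carrier_mat n n. \<forall>i<n. \<forall>j<n. 0 \<le> A $$ (i, j)}"

definition row_uniform :: "real mat \<Rightarrow> bool" where
  "row_uniform A \<longleftrightarrow>
    (\<forall>i<dim_row A. \<forall>j<dim_col A. \<forall>k<dim_col A.
      A $$ (i, j) \<noteq> 0 \<longrightarrow> A $$ (i, k) \<noteq> 0 \<longrightarrow> A $$ (i, j) = A $$ (i, k))"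

definition Aux :: "real mat \<Rightarrow> real mat" where
  "Aux A = mat (dim_row A) (dim_col A)
    (\<lambda>(i, j). if A $$ (i, j) \<noteq> 0 then \<Sum>k<dim_col A. A $$ (i, k) else 0)"

text \<open>The spectral radius of the library is that of a complex matrix.\<close>

definition rho :: "real mat \<Rightarrow> real" where
  "rho A = spectral_radius (map_mat complex_of_real A)"

definition eta :: "real mat \<Rightarrow> real set" where
  "eta B = {rho A | A. A \<in> nonneg_mats (dim_row B) \<and> Aux A = B}"

definition mat_digraph :: "real mat \<Rightarrow> (nat, nat \<times> nat) pre_digraph" where
  "mat_digraph A = \<lparr> verts = {0..<dim_row A},
    arcs = {(i, j). i < dim_row A \<and> j < dim_col A \<and> A $$ (i, j) \<noteq> 0},
    tail = fst, head = snd \<rparr>"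

definition mat_weight :: "real mat \<Rightarrow> (nat \<times> nat) weight_fun" where
  "mat_weight A = (\<lambda>(i, j). A $$ (i, j))"

definition cycle_gmean :: "'b weight_fun \<Rightarrow> 'b awalk \<Rightarrow> real" where
  "cycle_gmean w p = root (length p) (prod_list (map w p))"

text \<open>The cycles of the library are the elementary ones, loops included; a finite digraph has only
  finitely many of them.\<close>

definition max_cycle_gmean :: "('a, 'b) pre_digraph \<Rightarrow> 'b weight_fun \<Rightarrow> real" where
  "max_cycle_gmean G w =
    (if \<exists>p. pre_digraph.cycle G p then Max (cycle_gmean w ` {p. pre_digraph.cycle G p}) else 0)"

definition min_cycle_gmean :: "('a, 'b) pre_digraph \<Rightarrow> 'b weight_fun \<Rightarrow> real" where
  "min_cycle_gmean G w =
    (if \<exists>p. pre_digraph.cycle G p then Min (cycle_gmean w ` {p. pre_digraph.cycle G p}) else 0)"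

definition mu :: "real mat \<Rightarrow> real" where
  "mu A = max_cycle_gmean (mat_digraph A) (mat_weight A)"

definition nu :: "real mat \<Rightarrow> real" where
  "nu A = min_cycle_gmean (mat_digraph A) (mat_weight A)"

definition sunflower_subgraphs :: "('a, 'b) pre_digraph \<Rightarrow> ('a, 'b) pre_digraph set" where
  "sunflower_subgraphs G =
    {H. spanning H G \<and> (\<forall>v\<in>verts G. out_arcs G v \<noteq> {} \<longrightarrow> (\<exists>!e. e \<in> out_arcs H v))}"

definition sunflower_max :: "real mat \<Rightarrow> real" where
  "sunflower_max B =
    Max ((\<lambda>H. max_cycle_gmean H (mat_weight B)) ` sunflower_subgraphs (mat_digraph B))"

definition sunflower_min :: "real mat \<Rightarrow> real" where
  "sunflower_min B =
    Min ((\<lambda>H. max_cycle_gmean H (mat_weight B)) ` sunflower_subgraphs (mat_digraph B))"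

text \<open>Classes are indexed by the node sets \<open>C\<close> of the strongly connected components; the class
  itself is the principal submatrix on \<open>C\<close>.\<close>

definition class_mat :: "real mat \<Rightarrow> nat set \<Rightarrow> real mat" where
  "class_mat B C = submatrix B C C"

definition trivial_class :: "real mat \<Rightarrow> nat set \<Rightarrow> bool" where
  "trivial_class B C \<longleftrightarrow> class_mat B C = 0\<^sub>m 1 1"

definition final_classes :: "real mat \<Rightarrow> nat set set" where
  "final_classes B = {C \<in> pre_digraph.sccs_verts (mat_digraph B).
    \<not> (\<exists>D \<in> pre_digraph.sccs_verts (mat_digraph B). D \<noteq> C \<and>
        (\<exists>(i, j) \<in> arcs (mat_digraph B). i \<in> C \<and> j \<in> D))}"

end

theory Submission
  imports Defs
begin

text \<open>Write \<open>b i\<close> for the nonzero value of row \<open>i\<close> of \<open>B\<close>. The matrices \<open>A\<close> with auxiliary matrix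
  \<open>B\<close> are those with entries \<open>B i j * p i j\<close> for strictly positive weights \<open>p\<close> on the support of
  \<open>B\<close> with row sums 1. Bounds on cycle means are dual to potentials: all cycle means are at most
  \<open>a\<close> iff \<open>b i * x j \<le> a * x i\<close> on all arcs for some positive \<open>x\<close>, and similarly from below.
  Averaging such inequalities with the weights \<open>p\<close> gives \<open>A x \<le> a x\<close> or \<open>A x \<ge> a x\<close>, hence bounds
  on the spectral radius. An endpoint is attained only if the inequalities are equalities on a closed
  set of indices, respectively on each final class realizing the minimum. Conversely, weights
  concentrated on a sunflower bring the spectral radius close to the cycle mean of the sunflower,
  and it depends continuously on the weights, so every value in between is attained.\<close>

subsection \<open>Cycle means and potentials\<close>

text \<open>A sunflower is only a limit of admissible matrices, since every arc must keep positive
  weight. This shapes the key condition: strictly positive weights can average the values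
  \<open>B $$ (i, j) * x j\<close> of a row to at most \<open>l * x i\<close> iff all of them are at
  most that bound or one is strictly smaller. The two endpoints are not symmetric. Every elementary
  cycle extends to a sunflower, so \<open>sunflower_max B\<close> is governed by a potential on all
  of \<open>B\<close>. From below, a sunflower can lead each node outside the final classes towards
  one of them, and only inside a final class is it forced to close a cycle; hence
  \<open>sunflower_min B\<close> depends on final classes alone. A cycle is used as a finite set
  whose nodes have successors inside the set, with a potential that is tight on these arcs. Perron
  vectors are replaced by the moduli of a complex eigenvector; these satisfy only an inequality,
  which is enough when vectors are compared at an index where their quotient is extremal. Potentials
  exist only at positive levels, so bounds at a level that may be 0 are obtained from all larger
  levels.\<close>

text \<open>If \<open>a < b\<close>, a step from \<open>v\<close> to \<open>u\<close> would shrink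
  the quotient \<open>x / y\<close> by a factor of at most \<open>a / b\<close>, which is impossible
  where the quotient is minimal on \<open>K\<close>. This replaces multiplying inequalities around a
  cycle.\<close>

lemma potential_compare:
  fixes x y :: "'a \<Rightarrow> real"
  assumes K: "finite K" "K \<noteq> {}" and pos: "\<And>v. 0 < x v" "\<And>v. 0 < y v"
    and step: "\<And>v. v \<in> K \<Longrightarrow> \<exists>u\<in>K. \<exists>c>0. c * x u \<le> a * x v \<and> b * y v \<le> c * y u"
  shows "b \<le> a"
proof (rule ccontr)
  assume "\<not> b \<le> a"
  then have ab: "a < b" by simp
  obtain v where v: "v \<in> K" and min: "\<And>u. u \<in> K \<Longrightarrow> x v / y v \<le> x u / y u"
    using arg_min_if_finite[OF K, of "\<lambda>u. x u / y u"] by (meson not_le_imp_less)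
  obtain u c where u: "u \<in> K" "c > 0" "c * x u \<le> a * x v" "b * y v \<le> c * y u"
    using step[OF v] by blast
  have "0 < a" using u pos by (smt (verit) mult_pos_pos zero_less_mult_pos2)
  have "x v * y u \<le> x u * y v" using min[OF u(1)] pos[of u] pos[of v] by (simp add: field_simps)
  then have "c * (x v * y u) \<le> c * (x u * y v)" using u by simp
  also have "\<dots> \<le> a * x v * y v" using u(3) pos(2)[of v]
    by (metis less_imp_le mult.assoc mult_right_mono)
  also have "\<dots> < b * x v * y v" using ab pos by simp
  also have "\<dots> = x v * (b * y v)" by simp
  also have "\<dots> \<le> x v * (c * y u)" using u(4) pos(1)[of v] by (intro mult_left_mono) auto
  finally show False by (simp add: mult_ac)
qed

lemma prod_list_pos: "(\<And>e. e \<in> set p \<Longrightarrow> 0 < w e) \<Longrightarrow> 0 < prod_list (map w p)"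
  for w :: "'b \<Rightarrow> real"
  by (induction p) auto

lemma prod_list_divide_const:
  "prod_list (map (\<lambda>e. w e / a) p) = prod_list (map w p) / a ^ length p" for a :: real
  by (induction p) auto

lemma prod_list_const_divide:
  "prod_list (map (\<lambda>e. a / w e) p) = a ^ length p / prod_list (map w p)" for a :: real
  by (induction p) auto

lemma cycle_gmean_power:
  assumes "p \<noteq> []" "\<And>e. e \<in> set p \<Longrightarrow> 0 < w e"
  shows "cycle_gmean w p ^ length p = prod_list (map w p)" "0 < cycle_gmean w p"
  using assms prod_list_pos[of p w] by (auto simp: cycle_gmean_def)

context fin_digraph
begin

lemma cycle_nonempty: "cycle p \<Longrightarrow> p \<noteq> [] \<and> set p \<subseteq> arcs G"
  by (auto simp: cycle_def awalk_def)

lemma finite_cycles: "finite {p. cycle p}"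
proof (rule finite_subset)
  show "{p. cycle p} \<subseteq> {p. set p \<subseteq> arcs G \<and> distinct p}"
    by (auto simp: cycle_conv awalk_def)
  show "finite {p. set p \<subseteq> arcs G \<and> distinct p}"
    by (rule finite_subset_distinct) simp
qed

text \<open>A closed walk that is not a cycle contains a shorter closed walk; cutting it out leaves
  another shorter one, and the product factors over the two.\<close>

lemma prod_closed_walk_le_1:
  fixes w :: "'b \<Rightarrow> real"
  assumes w: "\<And>e. e \<in> arcs G \<Longrightarrow> 0 < w e"
    and cyc: "\<And>p. cycle p \<Longrightarrow> prod_list (map w p) \<le> 1"
    and "awalk u p u"
  shows "prod_list (map w p) \<le> 1"
  using assms(3)
proof (induction "length p" arbitrary: u p rule: less_induct)
  case less
  show ?case
  \<comment> \<open>The start node always reappears at the end, so only repetitions in the tail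
    count. Without its first arc the walk can be cut at such a repetition.\<close>
  proof (cases "p = [] \<or> distinct (tl (awalk_verts u p))")
    case True
    then show ?thesis using cyc[of p] less.prems unfolding cycle_def by (cases "p = []") auto
  next
    case False
    then obtain e es where p: "p = e # es" by (cases p) auto
    with False less.prems have es: "awalk (head G e) es u" "\<not> distinct (awalk_verts (head G e) es)"
      and e: "e \<in> arcs G" "tail G e = u"
      by (auto simp: awalk_Cons_iff)
    obtain q r s z where d: "es = q @ r @ s" "0 < length r"
      "awalk (head G e) q z" "awalk z r z" "awalk z s u"
      using awalk_not_distinct_decomp[OF es] by auto
    have 1: "prod_list (map w r) \<le> 1" using less.hyps[of r z] d p by auto
    have "awalk u (e # q @ s) u" using d e by (auto simp: awalk_Cons_iff)
    then have 2: "prod_list (map w (e # q @ s)) \<le> 1" using less.hyps[of "e # q @ s" u] d p by auto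
    have sub: "set r \<subseteq> arcs G" "set (e # q @ s) \<subseteq> arcs G" using d e by (auto simp: awalk_def)
    have 3: "0 < prod_list (map w r)" "0 < prod_list (map w (e # q @ s))"
      using sub w by (intro prod_list_pos; blast)+
    have "prod_list (map w p) = prod_list (map w r) * prod_list (map w (e # q @ s))"
      by (simp add: p d)
    also have "\<dots> \<le> 1" using 1 2 3 mult_le_one by (metis less_imp_le)
    finally show ?thesis .
  qed
qed

text \<open>Removing closed subwalks never lowers the product. Thus the supremum over all walks is a
  maximum over the finitely many simple paths.\<close>

lemma prod_walk_le_apath:
  fixes w :: "'b \<Rightarrow> real"
  assumes w: "\<And>e. e \<in> arcs G \<Longrightarrow> 0 < w e"
    and cyc: "\<And>p. cycle p \<Longrightarrow> prod_list (map w p) \<le> 1"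
    and "awalk u p v"
  shows "\<exists>q. apath u q v \<and> prod_list (map w p) \<le> prod_list (map w q)"
  using assms(3)
proof (induction "length p" arbitrary: p rule: less_induct)
  case less
  show ?case
  proof (cases "distinct (awalk_verts u p)")
    case True
    then show ?thesis using less.prems by (auto simp: apath_def)
  next
    case False
    obtain q r s z where d: "p = q @ r @ s" "0 < length r" "awalk u q z" "awalk z r z" "awalk z s v"
      using awalk_not_distinct_decomp[OF less.prems False] by auto
    have 1: "prod_list (map w r) \<le> 1" using prod_closed_walk_le_1[OF w cyc d(4)] .
    have "awalk u (q @ s) v" using d by auto
    then obtain t where t: "apath u t v" "prod_list (map w (q @ s)) \<le> prod_list (map w t)"
      using less.hyps[of "q @ s"] d by auto
    have sub: "set r \<subseteq> arcs G" "set (q @ s) \<subseteq> arcs G" using d by (auto simp: awalk_def)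
    have 3: "0 < prod_list (map w r)" "0 < prod_list (map w (q @ s))"
      using sub w by (intro prod_list_pos; blast)+
    have "prod_list (map w p) = prod_list (map w r) * prod_list (map w (q @ s))"
      by (simp add: d)
    also have "\<dots> \<le> prod_list (map w (q @ s))" using 1 3 mult_left_le_one_le
      by (metis less_imp_le)
    finally show ?thesis using t by fastforce
  qed
qed

text \<open>The potential at \<open>v\<close> is the largest weight product of a simple path that
  starts at \<open>v\<close>. Prepending an arc to a best path from its head gives a walk from its
  tail, which some simple path dominates.\<close>

lemma ex_potential:
  fixes w :: "'b \<Rightarrow> real"
  assumes w: "\<And>e. e \<in> arcs G \<Longrightarrow> 0 < w e"
    and cyc: "\<And>p. cycle p \<Longrightarrow> prod_list (map w p) \<le> 1"
  obtains x :: "'a \<Rightarrow> real"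
    where "\<And>v. 0 < x v" "\<And>e. e \<in> arcs G \<Longrightarrow> w e * x (head G e) \<le> x (tail G e)"
proof -
  define P where "P v = (\<lambda>q. prod_list (map w q)) ` {q. \<exists>u. apath v q u}" for v
  define x where "x v = (if v \<in> verts G then Max (P v) else 1)" for v
  have fin: "finite (P v)" for v
  proof -
    have "{q. \<exists>u. apath v q u} \<subseteq> (fst o snd) ` {(u,p,v). apath u p v}" by force
    then have "finite {q. \<exists>u. apath v q u}" using apaths_finite_triple by (rule finite_surj[rotated])
    then show ?thesis by (simp add: P_def)
  qed
  \<comment> \<open>The empty path, of product 1, is always available.\<close>
  have ne: "P v \<noteq> {}" if "v \<in> verts G" for v
    using that apath_Nil_iff[of v v] by (auto simp: P_def)
  have Ppos: "0 < t" if "t \<in> P v" for t v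
    using that w by (auto simp: P_def apath_def awalk_def intro!: prod_list_pos)
  show ?thesis
  proof
    show "0 < x v" for v using Max_in[OF fin ne, of v] Ppos by (auto simp: x_def)
    fix e assume e: "e \<in> arcs G"
    then have vs: "head G e \<in> verts G" "tail G e \<in> verts G" by auto
    obtain q u where q: "apath (head G e) q u" "x (head G e) = prod_list (map w q)"
      using Max_in[OF fin ne[OF vs(1)]] vs by (auto simp: x_def P_def)
    have "awalk (tail G e) (e # q) u" using q e by (auto simp: awalk_Cons_iff apath_def)
    then obtain r where r: "apath (tail G e) r u" "prod_list (map w (e # q)) \<le> prod_list (map w r)"
      using prod_walk_le_apath[of w] w cyc by blast
    have "prod_list (map w r) \<in> P (tail G e)" using r(1) unfolding P_def by blast
    then have "prod_list (map w r) \<le> x (tail G e)"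
      using vs fin unfolding x_def by simp
    then show "w e * x (head G e) \<le> x (tail G e)" using r q by simp
  qed
qed

text \<open>Without cycles the constant weight 2 satisfies the cycle condition vacuously. The
  resulting potential at least halves along every arc, although one can step inside the finite set
  \<open>K\<close> forever.\<close>

lemma ex_cycle_if_no_exit:
  assumes K: "finite K" "K \<noteq> {}"
    and out: "\<And>v. v \<in> K \<Longrightarrow> \<exists>e\<in>arcs G. tail G e = v \<and> head G e \<in> K"
  shows "\<exists>p. cycle p"
proof (rule ccontr)
  assume "\<not> ?thesis"
  then obtain x :: "'a \<Rightarrow> real"
    where x: "\<And>v. 0 < x v" "\<And>e. e \<in> arcs G \<Longrightarrow> 2 * x (head G e) \<le> x (tail G e)"
    using ex_potential[of "\<lambda>_. 2"] by auto
  have "(2::real) \<le> 1"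
  proof (rule potential_compare[OF K x(1)])
    show "\<exists>u\<in>K. \<exists>c>0. c * x u \<le> 1 * x v \<and> 2 * (1::real) \<le> c * 1" if "v \<in> K" for v
    proof -
      obtain e where "e \<in> arcs G" "tail G e = v" "head G e \<in> K" using out[OF \<open>v \<in> K\<close>] by blast
      then show ?thesis using x(2)[of e] by (intro bexI[of _ "head G e"] exI[of _ 2]) auto
    qed
  qed auto
  then show False by simp
qed

text \<open>Going once around the cycle, each arc dictates the value of \<open>x\<close> at its
  head. The values close up because the product of the factors \<open>l / w\<close> over the cycle
  is 1 exactly when \<open>l\<close> is the geometric mean.\<close>

lemma cycle_tight_potential:
  fixes w :: "'b \<Rightarrow> real"
  assumes p: "cycle p" and w: "\<And>e. e \<in> arcs G \<Longrightarrow> 0 < w e"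
  obtains K x where "K \<noteq> {}" "K \<subseteq> verts G" "\<And>v. 0 < x v"
    "\<And>v. v \<in> K \<Longrightarrow>
      \<exists>e\<in>arcs G. tail G e = v \<and> head G e \<in> K \<and> w e * x (head G e) = cycle_gmean w p * x v"
proof -
  obtain u where u: "awalk u p u" "distinct (tl (awalk_verts u p))" "p \<noteq> []"
    using p by (auto simp: cycle_def)
  define k where "k = length p"
  define l where "l = cycle_gmean w p"
  have sub: "set p \<subseteq> arcs G" using u by (auto simp: awalk_def)
  have l: "0 < l" "l ^ k = prod_list (map w p)"
    using cycle_gmean_power[OF u(3), of w] w sub by (auto simp: l_def k_def)
  have verts_tail: "awalk_verts a q = map (tail G) q @ [b]" if "cas a q b" for a q b
    using that by (induction q arbitrary: a) auto
  have verts_head: "awalk_verts a q = a # map (head G) q" if "cas a q b" for a q b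
    using that by (induction q arbitrary: a) auto
  \<comment> \<open>The node list read off the tails and read off the heads; this yields the cyclic
    successor relation and relates the two arc ends.\<close>
  have eq: "map (tail G) p @ [u] = u # map (head G) p"
    using verts_tail[of u p u] verts_head[of u p u] u by (auto simp: awalk_def)
  have k: "0 < k" using u by (simp add: k_def)
  have t0: "tail G (p ! 0) = u" using arg_cong[OF eq, of "\<lambda>xs. xs ! 0"] u(3)
    by (simp add: nth_append)
  have th: "head G (p ! i) = tail G (p ! (Suc i mod k))" if "i < k" for i
  proof (cases "Suc i < k")
    case True
    then show ?thesis using arg_cong[OF eq, of "\<lambda>xs. xs ! Suc i"] by (simp add: k_def nth_append)
  next
    case False
    then have "Suc i = k" using that by simp
    then have k_Suc: "k = Suc i" by simp
    have "(u # map (head G) p) ! k = head G (p ! i)"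
      unfolding k_Suc using that by (simp add: k_def)
    then have "head G (p ! i) = (u # map (head G) p) ! k" ..
    also have "\<dots> = u" by (simp only: eq[symmetric]) (simp add: k_def nth_append)
    finally show ?thesis using t0 \<open>Suc i = k\<close> by simp
  qed
  \<comment> \<open>A cycle has distinct heads by definition; the tails form the same
    multiset.\<close>
  have "distinct (map (tail G) p)"
  proof -
    have "mset (map (tail G) p @ [u]) = mset (u # map (head G) p)" by (simp only: eq)
    then have "mset (map (tail G) p) = mset (map (head G) p)" by simp
    moreover have "distinct (map (head G) p)" using u verts_head[of u p u] by (auto simp: awalk_def)
    ultimately show ?thesis by (metis mset_eq_imp_distinct_iff)
  qed
  then have inj: "i = j" if "tail G (p ! i) = tail G (p ! j)" "i < k" "j < k" for i j
    using that by (simp add: distinct_conv_nth k_def) metis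
  define K where "K = (\<lambda>i. tail G (p ! i)) ` {..<k}"
  define idx where "idx v = (THE i. i < k \<and> tail G (p ! i) = v)" for v
  define y where "y i = (\<Prod>j<i. l / w (p ! j))" for i
  define x where "x v = (if v \<in> K then y (idx v) else 1)" for v
  have idx: "idx (tail G (p ! i)) = i" if "i < k" for i
    unfolding idx_def using that inj by (intro the_equality) auto
  have xt: "x (tail G (p ! i)) = y i" if "i < k" for i
    using that idx by (auto simp: x_def K_def)
  have wp: "0 < w (p ! i)" if "i < k" for i
    using that sub w nth_mem[of i p] unfolding k_def by blast
  have ypos: "0 < y i" if "i \<le> k" for i unfolding y_def using that l wp by (intro prod_pos) auto
  have yk: "y k = 1"
  proof -
    have "y k = l ^ k / (\<Prod>j<k. w (p ! j))" by (simp add: y_def prod_dividef)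
    also have "(\<Prod>j<k. w (p ! j)) = prod_list (map w p)"
      by (simp add: prod.list_conv_set_nth k_def atLeast0LessThan)
    finally show ?thesis using l k by (metis divide_self power_not_zero less_irrefl)
  qed
  show ?thesis
  proof (rule that[of K x])
    show "K \<noteq> {}" using k by (auto simp: K_def)
    show "K \<subseteq> verts G" using sub tail_in_verts nth_mem unfolding K_def k_def by blast
    show "0 < x v" for v
    proof (cases "v \<in> K")
      case True
      then obtain i where "i < k" "v = tail G (p ! i)" by (auto simp: K_def)
      then show ?thesis using xt[of i] ypos[of i] by simp
    qed (simp add: x_def)
    fix v assume "v \<in> K"
    then obtain i where i: "i < k" "v = tail G (p ! i)" by (auto simp: K_def)
    have "x (head G (p ! i)) = y (Suc i)"
    proof (cases "Suc i < k")
      case True then show ?thesis using th[OF i(1)] xt by simp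
    next
      case False
      then have "Suc i = k" using i by simp
      then show ?thesis using th[OF i(1)] xt[of 0] yk k by (simp add: y_def)
    qed
    also have "\<dots> = l / w (p ! i) * y i" by (simp add: y_def)
    finally have "w (p ! i) * x (head G (p ! i)) = l * x v"
      using wp[OF i(1)] xt[OF i(1)] i by simp
    moreover have "head G (p ! i) \<in> K" using th[OF i(1)] k by (auto simp: K_def)
    ultimately show "\<exists>e\<in>arcs G. tail G e = v \<and> head G e \<in> K
        \<and> w e * x (head G e) = cycle_gmean w p * x v"
      using i sub by (intro bexI[of _ "p ! i"]) (auto simp: l_def k_def)
  qed
qed

section \<open>Duality between cycle means and potentials\<close>

text \<open>The easy half of the duality: on the node set of the cycle, the given potential is
  compared with the one that is tight at the level of the cycle mean. For
  \<open>le_cycle_gmean\<close> the two exchange roles.\<close>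

lemma cycle_gmean_le:
  assumes p: "cycle p" and w: "\<And>e. e \<in> arcs G \<Longrightarrow> 0 < w e" and x: "\<And>v. 0 < x v"
    "\<And>e. e \<in> arcs G \<Longrightarrow> w e * x (head G e) \<le> a * x (tail G e)"
  shows "cycle_gmean w p \<le> a"
proof -
  obtain K y where K: "K \<noteq> {}" "K \<subseteq> verts G" "\<And>v. 0 < y v" "\<And>v. v \<in> K \<Longrightarrow>
      \<exists>e\<in>arcs G. tail G e = v \<and> head G e \<in> K \<and> w e * y (head G e) = cycle_gmean w p * y v"
    using cycle_tight_potential[OF p, of w] w by blast
  have "finite K" using K by (auto intro: finite_subset)
  then show ?thesis
  proof (rule potential_compare[OF _ K(1) x(1) K(3)])
    show "\<exists>u\<in>K. \<exists>c>0. c * x u \<le> a * x v \<and> cycle_gmean w p * y v \<le> c * y u" if "v \<in> K" for v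
      using K(4)[OF that] x(2) w by (metis order_refl)
  qed
qed

lemma le_cycle_gmean:
  assumes p: "cycle p" and w: "\<And>e. e \<in> arcs G \<Longrightarrow> 0 < w e" and x: "\<And>v. 0 < x v"
    "\<And>e. e \<in> arcs G \<Longrightarrow> a * x (tail G e) \<le> w e * x (head G e)"
  shows "a \<le> cycle_gmean w p"
proof -
  obtain K y where K: "K \<noteq> {}" "K \<subseteq> verts G" "\<And>v. 0 < y v" "\<And>v. v \<in> K \<Longrightarrow>
      \<exists>e\<in>arcs G. tail G e = v \<and> head G e \<in> K \<and> w e * y (head G e) = cycle_gmean w p * y v"
    using cycle_tight_potential[OF p, of w] w by blast
  have "finite K" using K by (auto intro: finite_subset)
  then show ?thesis
  proof (rule potential_compare[OF _ K(1) K(3) x(1)])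
    show "\<exists>u\<in>K. \<exists>c>0. c * y u \<le> cycle_gmean w p * y v \<and> a * x v \<le> c * x u" if "v \<in> K" for v
      using K(4)[OF that] x(2) w by (metis order_refl)
  qed
qed

text \<open>The hard half: after division of the weights by \<open>a\<close>, the bound on the cycle
  means says that cycle products are at most 1.\<close>

lemma ex_upper_potential:
  assumes w: "\<And>e. e \<in> arcs G \<Longrightarrow> 0 < w e" and a: "0 < a"
    and cyc: "\<And>p. cycle p \<Longrightarrow> cycle_gmean w p \<le> a"
  obtains x :: "'a \<Rightarrow> real" where "\<And>v. 0 < x v"
    "\<And>e. e \<in> arcs G \<Longrightarrow> w e * x (head G e) \<le> a * x (tail G e)"
proof (rule ex_potential[of "\<lambda>e. w e / a"])
  show "0 < w e / a" if "e \<in> arcs G" for e using w a that by simp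
  show "prod_list (map (\<lambda>e. w e / a) p) \<le> 1" if "cycle p" for p
  proof -
    have g: "cycle_gmean w p ^ length p = prod_list (map w p)" "0 < cycle_gmean w p"
      using cycle_gmean_power[of p w] cycle_nonempty[OF that] w by auto
    show ?thesis using power_mono[OF cyc[OF that], of "length p"] g a
      by (simp add: prod_list_divide_const)
  qed
next
  fix x :: "'a \<Rightarrow> real"
  assume "\<And>v. 0 < x v" "\<And>e. e \<in> arcs G \<Longrightarrow> w e / a * x (head G e) \<le> x (tail G e)"
  then show ?thesis using that[of x] a by (simp add: field_simps)
qed

lemma ex_lower_potential:
  assumes w: "\<And>e. e \<in> arcs G \<Longrightarrow> 0 < w e" and a: "0 < a"
    and cyc: "\<And>p. cycle p \<Longrightarrow> a \<le> cycle_gmean w p"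
  obtains x :: "'a \<Rightarrow> real" where "\<And>v. 0 < x v"
    "\<And>e. e \<in> arcs G \<Longrightarrow> a * x (tail G e) \<le> w e * x (head G e)"
proof (rule ex_potential[of "\<lambda>e. a / w e"])
  show "0 < a / w e" if "e \<in> arcs G" for e using w a that by simp
  show "prod_list (map (\<lambda>e. a / w e) p) \<le> 1" if "cycle p" for p
  proof -
    have g: "cycle_gmean w p ^ length p = prod_list (map w p)" "0 < cycle_gmean w p"
      using cycle_gmean_power[of p w] cycle_nonempty[OF that] w by auto
    have "0 < prod_list (map w p)" using g by (metis zero_less_power)
    then show ?thesis using power_mono[OF cyc[OF that], of "length p"] g a
      by (simp add: prod_list_const_divide)
  qed
next
  fix x :: "'a \<Rightarrow> real"
  assume x: "\<And>v. 0 < x v" "\<And>e. e \<in> arcs G \<Longrightarrow> a / w e * x (head G e) \<le> x (tail G e)"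
  show ?thesis
  \<comment> \<open>\<open>x\<close> belongs to the reciprocal weights \<open>a / w e\<close>;
    taking reciprocals of its values turns the inequality around.\<close>
  proof (rule that[of "\<lambda>v. 1 / x v"])
    fix e assume e: "e \<in> arcs G"
    show "a * (1 / x (tail G e)) \<le> w e * (1 / x (head G e))"
      using x(2)[OF e] x(1)[of "head G e"] x(1)[of "tail G e"] w[OF e]
      by (simp add: field_simps)
  qed (use x in auto)
qed

section \<open>Extremal cycle means and their attainment\<close>

lemma cycle_gmean_le_max: "cycle p \<Longrightarrow> cycle_gmean w p \<le> max_cycle_gmean G w"
  using finite_cycles by (auto simp: max_cycle_gmean_def intro!: Max_ge)

lemma min_le_cycle_gmean: "cycle p \<Longrightarrow> min_cycle_gmean G w \<le> cycle_gmean w p"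
  using finite_cycles by (auto simp: min_cycle_gmean_def intro!: Min_le)

lemma max_cycle_gmean_attained:
  assumes "\<exists>p. cycle p"
  obtains p where "cycle p" "cycle_gmean w p = max_cycle_gmean G w"
proof -
  have "Max (cycle_gmean w ` {p. cycle p}) \<in> cycle_gmean w ` {p. cycle p}"
    using finite_cycles assms by (intro Max_in) auto
  then show ?thesis using that assms unfolding max_cycle_gmean_def by (auto simp del: Max_in)
qed

lemma min_cycle_gmean_attained:
  assumes "\<exists>p. cycle p"
  obtains p where "cycle p" "cycle_gmean w p = min_cycle_gmean G w"
proof -
  have "Min (cycle_gmean w ` {p. cycle p}) \<in> cycle_gmean w ` {p. cycle p}"
    using finite_cycles assms by (intro Min_in) auto
  then show ?thesis using that assms unfolding min_cycle_gmean_def by (auto simp del: Min_in)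
qed

lemma cycle_gmean_pos:
  assumes "\<And>e. e \<in> arcs G \<Longrightarrow> 0 < w e" "cycle p"
  shows "0 < cycle_gmean w p"
  using cycle_gmean_power(2)[of p w] cycle_nonempty[of p] assms by blast

lemma cycle_gmean_bounds:
  assumes w: "\<And>e. e \<in> arcs G \<Longrightarrow> 0 < w e"
  shows "0 \<le> min_cycle_gmean G w" "min_cycle_gmean G w \<le> max_cycle_gmean G w"
proof -
  have "0 \<le> min_cycle_gmean G w \<and> min_cycle_gmean G w \<le> max_cycle_gmean G w"
  proof (cases "\<exists>p. cycle p")
    case True
    then obtain p where p: "cycle p" "cycle_gmean w p = min_cycle_gmean G w"
      by (rule min_cycle_gmean_attained)
    then show ?thesis using cycle_gmean_le_max[OF p(1), of w] cycle_gmean_pos[of w p] w by force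
  next
    case False
    then show ?thesis unfolding min_cycle_gmean_def max_cycle_gmean_def by auto
  qed
  then show "0 \<le> min_cycle_gmean G w" "min_cycle_gmean G w \<le> max_cycle_gmean G w" by auto
qed

end

subsection \<open>The spectral radius of a nonnegative matrix\<close>

text \<open>The vector consists of the moduli of an eigenvector for an eigenvalue of maximal
  modulus; the triangle inequality leaves only this one-sided relation.\<close>

lemma rho_subinvariant:
  assumes A: "A \<in> nonneg_mats n" and n: "0 < n"
  obtains y where "\<And>i. 0 \<le> y i" "\<exists>i<n. 0 < y i"
    "\<And>i. i < n \<Longrightarrow> rho A * y i \<le> (\<Sum>j<n. A $$ (i, j) * y j)"
proof -
  let ?C = "map_mat complex_of_real A"
  have Ac: "A \<in> carrier_mat n n" and nn: "\<And>i j. i < n \<Longrightarrow> j < n \<Longrightarrow> 0 \<le> A $$ (i, j)"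
    using A by (auto simp: nonneg_mats_def)
  then have C: "?C \<in> carrier_mat n n" by simp
  obtain a where a: "a \<in> spectrum ?C" "norm a = rho A"
    using spectral_radius_mem_max(1)[OF C n] by (auto simp: rho_def)
  then obtain z where z: "z \<in> carrier_vec n" "z \<noteq> 0\<^sub>v n" "?C *\<^sub>v z = a \<cdot>\<^sub>v z"
    using C by (auto simp: spectrum_def eigenvalue_def eigenvector_def)
  show ?thesis
  proof (rule that[of "\<lambda>i. norm (z $ i)"])
    show "\<exists>i<n. 0 < norm (z $ i)" using z by (auto simp: vec_eq_iff)
    fix i assume i: "i < n"
    have "a * z $ i = (?C *\<^sub>v z) $ i" using z i by simp
    also have "\<dots> = (\<Sum>j<n. complex_of_real (A $$ (i, j)) * z $ j)"
      using z(1) i Ac by (auto simp: scalar_prod_def atLeast0LessThan intro!: sum.cong)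
    finally have "rho A * norm (z $ i) = norm (\<Sum>j<n. complex_of_real (A $$ (i, j)) * z $ j)"
      by (metis a(2) norm_mult)
    also have "\<dots> \<le> (\<Sum>j<n. A $$ (i, j) * norm (z $ j))"
      using nn[OF i] by (intro sum_norm_le) (auto simp: norm_mult)
    finally show "rho A * norm (z $ i) \<le> (\<Sum>j<n. A $$ (i, j) * norm (z $ j))" .
  qed simp
qed

text \<open>Let \<open>y\<close> be subinvariant. At the index where \<open>y / x\<close> takes its
  maximum \<open>r\<close>, the chain \<open>rho A * y i\<close> \<le> \<open>r * (A x) i\<close>
  \<le> \<open>c * y i\<close> can be divided by \<open>y i > 0\<close>.\<close>

lemma rho_le:
  assumes A: "A \<in> nonneg_mats n" and n: "0 < n" and x: "\<And>i. 0 < x i"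
    "\<And>i. i < n \<Longrightarrow> (\<Sum>j<n. A $$ (i, j) * x j) \<le> c * x i"
  shows "rho A \<le> c"
proof -
  have nn: "\<And>i j. i < n \<Longrightarrow> j < n \<Longrightarrow> 0 \<le> A $$ (i, j)"
    using A by (auto simp: nonneg_mats_def)
  obtain y where y: "\<And>i. 0 \<le> y i" "\<exists>i<n. 0 < y i"
    "\<And>i. i < n \<Longrightarrow> rho A * y i \<le> (\<Sum>j<n. A $$ (i, j) * y j)"
    using rho_subinvariant[OF A n] by blast
  define r where "r = Max ((\<lambda>i. y i / x i) ` {..<n})"
  have "r \<in> (\<lambda>i. y i / x i) ` {..<n}" unfolding r_def using n by (intro Max_in) auto
  then obtain i where i: "i < n" "r = y i / x i" by auto
  have r: "y j \<le> r * x j" if "j < n" for j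
  proof -
    have "y j / x j \<le> r" unfolding r_def using that by (intro Max_ge) auto
    then show ?thesis using x(1)[of j] by (simp add: field_simps)
  qed
  obtain k where k: "k < n" "0 < y k" using y by blast
  have r0: "0 < r" using r[OF k(1)] k(2) x(1)[of k] by (metis less_le_trans zero_less_mult_pos2)
  have yi: "y i = r * x i" using i x(1)[of i] by simp
  have "rho A * y i \<le> (\<Sum>j<n. A $$ (i, j) * y j)" using y i by blast
  also have "\<dots> \<le> (\<Sum>j<n. r * (A $$ (i, j) * x j))"
    using mult_left_mono[OF r nn[OF i(1)]] by (intro sum_mono) (auto simp: mult_ac)
  also have "\<dots> = r * (\<Sum>j<n. A $$ (i, j) * x j)" by (simp add: sum_distrib_left)
  also have "\<dots> \<le> r * (c * x i)" using x(2)[OF i(1)] r0 by (intro mult_left_mono) auto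
  also have "\<dots> = c * y i" using yi by simp
  finally show ?thesis using yi r0 x(1)[of i] by simp
qed

lemma rho_nonneg:
  assumes A: "A \<in> nonneg_mats n" and n: "0 < n"
  shows "0 \<le> rho A"
proof -
  have C: "map_mat complex_of_real A \<in> carrier_mat n n" using A by (auto simp: nonneg_mats_def)
  then show ?thesis using spectral_radius_mem_max(1)[OF C n] by (auto simp: rho_def)
qed

lemma spectral_radius_smult_less_1:
  assumes A: "A \<in> carrier_mat n n" and n: "0 < n" and d: "0 < d" "rho A < d"
  shows "spectral_radius (map_mat complex_of_real ((1 / d) \<cdot>\<^sub>m A)) < 1"
proof -
  let ?A = "map_mat complex_of_real A"
  define C where "C = map_mat complex_of_real ((1 / d) \<cdot>\<^sub>m A)"
  have C: "C \<in> carrier_mat n n" and cA: "?A \<in> carrier_mat n n" using A by (auto simp: C_def)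
  have C_smult: "C = complex_of_real (1 / d) \<cdot>\<^sub>m ?A" by (rule eq_matI) (auto simp: C_def)
  have "spectral_radius C \<in> norm ` spectrum C" by (rule spectral_radius_mem_max(1)[OF C n])
  then obtain a where a: "a \<in> spectrum C" "norm a = spectral_radius C" by (auto simp: image_iff)
  then obtain z where z: "z \<in> carrier_vec n" "z \<noteq> 0\<^sub>v n" "C *\<^sub>v z = a \<cdot>\<^sub>v z"
    using C by (auto simp: spectrum_def eigenvalue_def eigenvector_def)
  have "C *\<^sub>v z = complex_of_real (1 / d) \<cdot>\<^sub>v (?A *\<^sub>v z)"
    unfolding C_smult using z(1) A by (intro eq_vecI) auto
  then have "complex_of_real d \<cdot>\<^sub>v (C *\<^sub>v z) = ?A *\<^sub>v z"
    using d by (simp add: smult_smult_assoc)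
  then have "?A *\<^sub>v z = (complex_of_real d * a) \<cdot>\<^sub>v z"
    unfolding z(3) by (simp add: smult_smult_assoc)
  then have "complex_of_real d * a \<in> spectrum ?A"
    using z(1,2) cA by (auto simp: spectrum_def eigenvalue_def eigenvector_def)
  then have "norm (complex_of_real d * a) \<le> rho A"
    unfolding rho_def by (intro spectral_radius_mem_max(2)[OF cA n] imageI)
  moreover have "norm (complex_of_real d * a) = d * norm a" using d by (simp add: norm_mult)
  ultimately have "d * norm a < d * 1" using d by linarith
  then show ?thesis using d(1) a(2) unfolding C_def by (simp only: mult_less_cancel_left_pos)
qed

text \<open>If the spectral radius were below \<open>c\<close>, the powers of \<open>A / d\<close> would stay bounded for
  some \<open>d < c\<close>, whereas \<open>A w \<ge> c w\<close> makes them grow like \<open>(c / d) ^ k\<close>.\<close>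

lemma rho_ge:
  assumes A: "A \<in> nonneg_mats n" and n: "0 < n" and w: "\<And>i. 0 \<le> w i" "k < n" "0 < w k"
    "\<And>i. i < n \<Longrightarrow> c * w i \<le> (\<Sum>j<n. A $$ (i, j) * w j)"
  shows "c \<le> rho A"
proof (rule ccontr)
  assume "\<not> c \<le> rho A"
  then obtain d where d: "rho A < d" "d < c" using dense[of "rho A" c] by auto
  have d0: "0 < d" using rho_nonneg[OF A n] d by simp
  have Ac: "A \<in> carrier_mat n n" and nn: "\<And>i j. i < n \<Longrightarrow> j < n \<Longrightarrow> 0 \<le> A $$ (i, j)"
    using A by (auto simp: nonneg_mats_def)
  define R where "R = (1 / d) \<cdot>\<^sub>m A"
  define C where "C = map_mat complex_of_real R"
  have Rc: "R \<in> carrier_mat n n" and C: "C \<in> carrier_mat n n" using Ac by (auto simp: R_def C_def)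
  have "spectral_radius C < 1"
    unfolding C_def R_def by (rule spectral_radius_smult_less_1[OF Ac n d0 d(1)])
  then obtain b where b: "\<And>k. norm_bound (C ^\<^sub>m k) b"
    using spectral_radius_jnf_norm_bound_less_1[OF C _ jordan_nf_exists[OF C]]
    char_poly_factorized[OF C] by blast
  have powR: "C ^\<^sub>m k = map_mat complex_of_real (R ^\<^sub>m k)" for k
    unfolding C_def by (rule of_real_hom.mat_hom_pow[OF Rc, symmetric])
  have Rk: "R ^\<^sub>m k \<in> carrier_mat n n" for k using Rc by simp
  have bound: "\<bar>(R ^\<^sub>m k) $$ (i, j)\<bar> \<le> b" if "i < n" "j < n" for i j k
  proof -
    have "dim_row (R ^\<^sub>m k) = n" "dim_col (R ^\<^sub>m k) = n" using Rk[of k] by auto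
    then show ?thesis using b[of k] that unfolding norm_bound_def powR
      by simp
  qed
  have Rnn: "\<And>i j. i < n \<Longrightarrow> j < n \<Longrightarrow> 0 \<le> R $$ (i, j)" using nn d0 Ac by (simp add: R_def)
  \<comment> \<open>Nonnegativity of the powers is carried along because the induction step
    multiplies inequalities by their entries.\<close>
  have grow: "(c / d) ^ l * w i \<le> (\<Sum>j<n. (R ^\<^sub>m l) $$ (i, j) * w j)
      \<and> (\<forall>j<n. 0 \<le> (R ^\<^sub>m l) $$ (i, j))" if "i < n" for i l
    using that
  proof (induction l)
    case 0
    have "(\<Sum>j<n. (R ^\<^sub>m 0) $$ (i, j) * w j) = (\<Sum>j<n. if j = i then w i else 0)"
      using 0 Rc by (intro sum.cong) auto
    then show ?case using 0 Rc by simp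
  next
    case (Suc l)
    have ent: "(R ^\<^sub>m Suc l) $$ (i, j) = (\<Sum>m<n. (R ^\<^sub>m l) $$ (i, m) * R $$ (m, j))" if "j < n" for j
      using that Suc.prems Rc Rk[of l] by (simp add: scalar_prod_def atLeast0LessThan)
    have IH: "(c / d) ^ l * w i \<le> (\<Sum>j<n. (R ^\<^sub>m l) $$ (i, j) * w j)"
      "\<And>j. j < n \<Longrightarrow> 0 \<le> (R ^\<^sub>m l) $$ (i, j)" using Suc by auto
    have step: "c / d * w m \<le> (\<Sum>j<n. R $$ (m, j) * w j)" if "m < n" for m
      using w(4)[OF that] d0 that Ac
      by (simp add: R_def sum_divide_distrib[symmetric] divide_right_mono)
    have "(c / d) ^ Suc l * w i = c / d * ((c / d) ^ l * w i)" by simp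
    also have "\<dots> \<le> c / d * (\<Sum>m<n. (R ^\<^sub>m l) $$ (i, m) * w m)"
      using IH(1) d d0 by (intro mult_left_mono) auto
    also have "\<dots> = (\<Sum>m<n. (R ^\<^sub>m l) $$ (i, m) * (c / d * w m))"
      by (simp add: sum_distrib_left mult_ac)
    also have "\<dots> \<le> (\<Sum>m<n. (R ^\<^sub>m l) $$ (i, m) * (\<Sum>j<n. R $$ (m, j) * w j))"
      using step IH(2) by (intro sum_mono mult_left_mono) auto
    also have "\<dots> = (\<Sum>m<n. \<Sum>j<n. (R ^\<^sub>m l) $$ (i, m) * R $$ (m, j) * w j)"
      by (simp add: sum_distrib_left mult_ac)
    also have "\<dots> = (\<Sum>j<n. \<Sum>m<n. (R ^\<^sub>m l) $$ (i, m) * R $$ (m, j) * w j)"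
      by (rule sum.swap)
    also have "\<dots> = (\<Sum>j<n. (R ^\<^sub>m Suc l) $$ (i, j) * w j)"
      by (intro sum.cong) (simp_all add: ent sum_distrib_right del: pow_mat.simps)
    finally show ?case
      using ent IH(2) Rnn by (auto simp del: pow_mat.simps intro!: sum_nonneg)
  qed
  define D where "D = (\<Sum>j<n. b * w j)"
  have "(c / d) ^ l \<le> D / w k" for l
  proof -
    have "(c / d) ^ l * w k \<le> (\<Sum>j<n. (R ^\<^sub>m l) $$ (k, j) * w j)" using grow[OF w(2)] by blast
    also have "\<dots> \<le> D" unfolding D_def
    proof (intro sum_mono mult_right_mono)
      show "(R ^\<^sub>m l) $$ (k, j) \<le> b" if "j \<in> {..<n}" for j using bound[OF w(2), of j l] that by auto
    qed (use w in auto)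
    finally show ?thesis using w(3) by (simp add: field_simps)
  qed
  moreover have "1 < c / d" using d d0 by simp
  ultimately show False by (metis not_le real_arch_pow)
qed

text \<open>Since \<open>K\<close> is finite, \<open>c\<close> can be raised to the least quotient
  \<open>e\<close> and still be exceeded; the weak bound \<open>rho_ge\<close> at \<open>e\<close>
  then gives a strict one at \<open>c\<close>.\<close>

lemma rho_gt:
  assumes A: "A \<in> nonneg_mats n" and n: "0 < n" and K: "K \<noteq> {}" "K \<subseteq> {..<n}"
    and w: "\<And>i. i \<in> K \<Longrightarrow> 0 < w i" "\<And>i. i \<in> K \<Longrightarrow> c * w i < (\<Sum>j\<in>K. A $$ (i, j) * w j)"
  shows "c < rho A"
proof -
  have nn: "\<And>i j. i < n \<Longrightarrow> j < n \<Longrightarrow> 0 \<le> A $$ (i, j)"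
    using A by (auto simp: nonneg_mats_def)
  have fin: "finite K" using K finite_subset by blast
  define v where "v i = (if i \<in> K then w i else 0)" for i
  define q where "q i = (\<Sum>j\<in>K. A $$ (i, j) * w j) / w i" for i
  define e where "e = Min (q ` K)"
  have "e \<in> q ` K" unfolding e_def using fin K by (intro Min_in) auto
  then have "c < e" using w by (auto simp: q_def field_simps)
  moreover obtain k where k: "k \<in> K" using K by auto
  have "e \<le> rho A"
  proof (rule rho_ge[OF A n, of v k])
    show "0 \<le> v i" for i using w by (auto simp: v_def less_imp_le)
    show "k < n" "0 < v k" using k K w by (auto simp: v_def)
    fix i assume i: "i < n"
    have eq: "(\<Sum>j<n. A $$ (i, j) * v j) = (\<Sum>j\<in>K. A $$ (i, j) * w j)"
      using K by (intro sum.mono_neutral_cong_right) (auto simp: v_def)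
    show "e * v i \<le> (\<Sum>j<n. A $$ (i, j) * v j)"
    proof (cases "i \<in> K")
      case True
      then have "e \<le> q i" unfolding e_def using fin by simp
      moreover have "v i = w i" using True by (simp add: v_def)
      ultimately show ?thesis unfolding eq using w(1)[OF True] by (simp add: q_def field_simps)
    next
      case False
      have "0 \<le> A $$ (i, j) * w j" if "j \<in> K" for j
        using nn[OF i, of j] w(1)[OF that] K(2) that by (simp add: subset_eq)
      then show ?thesis unfolding eq using False by (simp add: v_def sum_nonneg)
    qed
  qed
  ultimately show ?thesis by simp
qed

text \<open>Strictly positive weights can be concentrated on an index where \<open>g < L\<close>.\<close>

lemma ex_weights_le:
  fixes g :: "'a \<Rightarrow> real"
  assumes S: "finite S" "S \<noteq> {}" and g: "(\<forall>j\<in>S. g j \<le> L) \<or> (\<exists>j\<in>S. g j < L)"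
  shows "\<exists>q. (\<forall>j\<in>S. 0 < q j) \<and> sum q S = 1 \<and> (\<Sum>j\<in>S. q j * g j) \<le> L"
proof -
  define N where "N = real (card S)"
  have N: "0 < N" using S by (auto simp: N_def card_gt_0_iff)
  show ?thesis
  proof (cases "\<forall>j\<in>S. g j \<le> L")
    case True
    have "(\<Sum>j\<in>S. 1 / N * g j) \<le> (\<Sum>j\<in>S. 1 / N * L)"
      using True N by (intro sum_mono mult_left_mono) auto
    also have "\<dots> = L" using N by (simp add: N_def)
    finally show ?thesis using N by (intro exI[of _ "\<lambda>_. 1 / N"]) (auto simp: N_def)
  next
    case False
    then obtain k where k: "k \<in> S" "g k < L" using g by blast
    define a where "a = (\<Sum>j\<in>S. 1 / N * g j)"
    \<comment> \<open>The weights will be \<open>1 - t\<close> times the point mass at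
      \<open>k\<close> plus \<open>t\<close> times the uniform weights, with average
      \<open>g k + t * (a - g k)\<close>. The summand \<open>L - g k\<close> in the denominator
      keeps it positive and \<open>t\<close> at most 1.\<close>
    define t where "t = (L - g k) / (L - g k + \<bar>a - g k\<bar>)"
    have t: "0 < t" "t \<le> 1" using k by (auto simp: t_def)
    have ta: "t * (a - g k) \<le> L - g k"
    proof -
      have "t * (a - g k) \<le> t * (L - g k + \<bar>a - g k\<bar>)" using t k by (intro mult_left_mono) auto
      also have "\<dots> = L - g k" using k by (simp add: t_def)
      finally show ?thesis .
    qed
    define q where "q j = (1 - t) * (if j = k then 1 else 0) + t * (1 / N)" for j
    have "sum q S = (1 - t) * (\<Sum>j\<in>S. if j = k then 1 else 0) + t * (\<Sum>j\<in>S. 1 / N)"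
      unfolding q_def by (simp add: sum.distrib sum_distrib_left)
    also have "\<dots> = 1" using k S N by (simp add: N_def)
    finally have 1: "sum q S = 1" .
    have "(\<Sum>j\<in>S. q j * g j) = (\<Sum>j\<in>S. (1 - t) * (if j = k then g j else 0) + t * (1 / N * g j))"
      by (intro sum.cong) (auto simp: q_def algebra_simps)
    also have "\<dots> = (1 - t) * (\<Sum>j\<in>S. if j = k then g j else 0) + t * a"
      by (simp add: sum.distrib sum_distrib_left a_def)
    also have "\<dots> = g k + t * (a - g k)" using k S by (simp add: algebra_simps)
    also have "\<dots> \<le> L" using ta by simp
    finally have 2: "(\<Sum>j\<in>S. q j * g j) \<le> L" .
    have "0 < q j" for j
      unfolding q_def using t N by (intro add_nonneg_pos) auto
    with 1 2 show ?thesis by blast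
  qed
qed

subsection \<open>Cycle means of matrices and their classes\<close>

abbreviation has_cycle :: "real mat \<Rightarrow> bool" where
  "has_cycle A \<equiv> \<exists>p. pre_digraph.cycle (mat_digraph A) p"

lemma fin_digraph_mat_digraph:
  assumes "A \<in> nonneg_mats n"
  shows "fin_digraph (mat_digraph A)"
proof
  have "arcs (mat_digraph A) \<subseteq> {..<n} \<times> {..<n}"
    using assms by (auto simp: mat_digraph_def nonneg_mats_def)
  then show "finite (arcs (mat_digraph A))" by (rule finite_subset) simp
qed (use assms in \<open>auto simp: mat_digraph_def nonneg_mats_def\<close>)

lemma arcs_mat_digraph:
  assumes "A \<in> nonneg_mats n"
  shows "arcs (mat_digraph A) = {(i, j). i < n \<and> j < n \<and> A $$ (i, j) \<noteq> 0}"
  using assms by (auto simp: mat_digraph_def nonneg_mats_def)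

lemma mat_digraph_sel [simp]: "tail (mat_digraph A) = fst" "head (mat_digraph A) = snd"
  "verts (mat_digraph A) = {0..<dim_row A}"
  by (simp_all add: mat_digraph_def)

lemma mat_weight_Pair [simp]: "mat_weight A (i, j) = A $$ (i, j)"
  by (simp add: mat_weight_def)

lemma mat_weight_pos:
  assumes "A \<in> nonneg_mats n" "e \<in> arcs (mat_digraph A)"
  shows "0 < mat_weight A e"
proof -
  obtain i j where "e = (i, j)" by (cases e)
  then show ?thesis using assms by (auto simp: mat_digraph_def nonneg_mats_def less_le)
qed

lemma mu_le_imp_potential:
  assumes A: "A \<in> nonneg_mats n" and a: "0 < a" "mu A \<le> a"
  shows "\<exists>x. (\<forall>i. 0 < x i) \<and> (\<forall>i<n. \<forall>j<n. A $$ (i, j) * x j \<le> a * x i)"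
proof -
  interpret G: fin_digraph "mat_digraph A" by (rule fin_digraph_mat_digraph[OF A])
  have "G.cycle p \<Longrightarrow> cycle_gmean (mat_weight A) p \<le> a" for p
    using G.cycle_gmean_le_max[of p "mat_weight A"] a by (simp add: mu_def)
  then obtain x where x: "\<And>v. 0 < x v" "\<And>e. e \<in> arcs (mat_digraph A) \<Longrightarrow>
      mat_weight A e * x (head (mat_digraph A) e) \<le> a * x (tail (mat_digraph A) e)"
    using G.ex_upper_potential[of "mat_weight A" a] mat_weight_pos[OF A] a by blast
  have "A $$ (i, j) * x j \<le> a * x i" if "i < n" "j < n" for i j
  proof (cases "A $$ (i, j) = 0")
    case True
    then show ?thesis using a x(1)[of i] by simp
  next
    case False
    then show ?thesis using x(2)[of "(i, j)"] that by (simp add: arcs_mat_digraph[OF A])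
  qed
  then show ?thesis using x(1) by blast
qed

lemma mu_le:
  assumes A: "A \<in> nonneg_mats n" and a: "0 \<le> a" and x: "\<And>i. 0 < x i"
    "\<And>i j. i < n \<Longrightarrow> j < n \<Longrightarrow> A $$ (i, j) * x j \<le> a * x i"
  shows "mu A \<le> a"
proof -
  interpret G: fin_digraph "mat_digraph A" by (rule fin_digraph_mat_digraph[OF A])
  show ?thesis
  proof (cases "has_cycle A")
    case True
    then obtain p where p: "G.cycle p" "cycle_gmean (mat_weight A) p = mu A"
      using G.max_cycle_gmean_attained[of "mat_weight A"] unfolding mu_def by blast
    have "cycle_gmean (mat_weight A) p \<le> a"
      using x by (intro G.cycle_gmean_le[OF p(1) mat_weight_pos[OF A], where x = x])
        (auto simp: arcs_mat_digraph[OF A])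
    then show ?thesis using p by simp
  qed (use a in \<open>simp add: mu_def max_cycle_gmean_def\<close>)
qed

lemma nu_potential:
  assumes A: "A \<in> nonneg_mats n" and c: "has_cycle A"
  shows "\<exists>x. (\<forall>i. 0 < x i) \<and> (\<forall>i<n. \<forall>j<n. A $$ (i, j) \<noteq> 0 \<longrightarrow> nu A * x i \<le> A $$ (i, j) * x j)"
proof -
  interpret G: fin_digraph "mat_digraph A" by (rule fin_digraph_mat_digraph[OF A])
  obtain p where p: "G.cycle p" "cycle_gmean (mat_weight A) p = nu A"
    using G.min_cycle_gmean_attained[of "mat_weight A"] c unfolding nu_def by blast
  have pos: "0 < nu A" using G.cycle_gmean_pos[of "mat_weight A" p, OF mat_weight_pos[OF A] p(1)] p by simp
  have "G.cycle p \<Longrightarrow> nu A \<le> cycle_gmean (mat_weight A) p" for p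
    using G.min_le_cycle_gmean[of p "mat_weight A"] by (simp add: nu_def)
  then obtain x where x: "\<And>v. 0 < x v" "\<And>e. e \<in> arcs (mat_digraph A) \<Longrightarrow>
      nu A * x (tail (mat_digraph A) e) \<le> mat_weight A e * x (head (mat_digraph A) e)"
    using G.ex_lower_potential[of "mat_weight A" "nu A"] mat_weight_pos[OF A] pos by blast
  have "nu A * x i \<le> A $$ (i, j) * x j" if "i < n" "j < n" "A $$ (i, j) \<noteq> 0" for i j
    using x(2)[of "(i, j)"] that by (simp add: arcs_mat_digraph[OF A])
  then show "\<exists>x. (\<forall>i. 0 < x i)
      \<and> (\<forall>i<n. \<forall>j<n. A $$ (i, j) \<noteq> 0 \<longrightarrow> nu A * x i \<le> A $$ (i, j) * x j)"
    using x(1) by blast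
qed

lemma le_nu:
  assumes A: "A \<in> nonneg_mats n" and c: "has_cycle A" and x: "\<And>i. 0 < x i"
    "\<And>i j. i < n \<Longrightarrow> j < n \<Longrightarrow> A $$ (i, j) \<noteq> 0 \<Longrightarrow> a * x i \<le> A $$ (i, j) * x j"
  shows "a \<le> nu A"
proof -
  interpret G: fin_digraph "mat_digraph A" by (rule fin_digraph_mat_digraph[OF A])
  obtain p where p: "G.cycle p" "cycle_gmean (mat_weight A) p = nu A"
    using G.min_cycle_gmean_attained[of "mat_weight A"] c unfolding nu_def by blast
  have "a \<le> cycle_gmean (mat_weight A) p"
    using x by (intro G.le_cycle_gmean[OF p(1) mat_weight_pos[OF A], where x = x])
      (auto simp: arcs_mat_digraph[OF A])
  then show ?thesis using p by simp
qed

lemma nu_tight: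
  assumes A: "A \<in> nonneg_mats n" and c: "has_cycle A"
  shows "\<exists>K x. K \<noteq> {} \<and> K \<subseteq> {..<n} \<and> (\<forall>i. 0 < x i) \<and>
    (\<forall>i\<in>K. \<exists>j\<in>K. A $$ (i, j) \<noteq> 0 \<and> A $$ (i, j) * x j = nu A * x i)"
proof -
  interpret G: fin_digraph "mat_digraph A" by (rule fin_digraph_mat_digraph[OF A])
  obtain p where p: "G.cycle p" "cycle_gmean (mat_weight A) p = nu A"
    using G.min_cycle_gmean_attained[of "mat_weight A"] c unfolding nu_def by blast
  obtain K x where K: "K \<noteq> {}" "K \<subseteq> verts (mat_digraph A)" "\<And>v. 0 < x v"
    "\<And>v. v \<in> K \<Longrightarrow> \<exists>e\<in>arcs (mat_digraph A). tail (mat_digraph A) e = v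
      \<and> head (mat_digraph A) e \<in> K
      \<and> mat_weight A e * x (head (mat_digraph A) e) = cycle_gmean (mat_weight A) p * x v"
    using G.cycle_tight_potential[OF p(1), of "mat_weight A"] mat_weight_pos[OF A] by blast
  have "\<exists>j\<in>K. A $$ (i, j) \<noteq> 0 \<and> A $$ (i, j) * x j = nu A * x i" if "i \<in> K" for i
    using K(4)[OF that] p(2) by (auto simp: arcs_mat_digraph[OF A])
  moreover have "K \<subseteq> {..<n}" using K(2) A by (auto simp: nonneg_mats_def)
  ultimately show ?thesis using K(1,3) by blast
qed

lemma has_cycleI:
  assumes A: "A \<in> nonneg_mats n" and K: "K \<noteq> {}" "K \<subseteq> {..<n}"
    "\<And>i. i \<in> K \<Longrightarrow> \<exists>j\<in>K. A $$ (i, j) \<noteq> 0"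
  shows "has_cycle A"
proof -
  interpret G: fin_digraph "mat_digraph A" by (rule fin_digraph_mat_digraph[OF A])
  show ?thesis
  proof (rule G.ex_cycle_if_no_exit[OF _ K(1)])
    show "finite K" using K(2) finite_subset by blast
    fix i assume i: "i \<in> K"
    then obtain j where "j \<in> K" "A $$ (i, j) \<noteq> 0" using K(3) by blast
    then show "\<exists>e\<in>arcs (mat_digraph A). tail (mat_digraph A) e = i \<and> head (mat_digraph A) e \<in> K"
      using i K(2) by (intro bexI[of _ "(i, j)"]) (auto simp: arcs_mat_digraph[OF A])
  qed
qed

lemma acyclic_mu_nu: "\<not> has_cycle A \<Longrightarrow> mu A = 0 \<and> nu A = 0"
  by (simp add: mu_def nu_def max_cycle_gmean_def min_cycle_gmean_def)

lemma nu_bounds: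
  assumes A: "A \<in> nonneg_mats n"
  shows "0 \<le> nu A" "nu A \<le> mu A"
proof -
  interpret G: fin_digraph "mat_digraph A" by (rule fin_digraph_mat_digraph[OF A])
  show "0 \<le> nu A" "nu A \<le> mu A"
    using G.cycle_gmean_bounds[OF mat_weight_pos[OF A]] by (simp_all add: mu_def nu_def)
qed

section \<open>Transport to principal submatrices\<close>

text \<open>A submatrix is renumbered from 0, by \<open>pick\<close> in one direction and by the
  rank within \<open>C\<close> in the other. With both maps at hand, the statements about classes
  below keep the original indices of \<open>A\<close>.\<close>

lemma class_mat_reindex:
  assumes A: "A \<in> nonneg_mats n" and C: "C \<subseteq> {..<n}"
  obtains h g where "class_mat A C \<in> nonneg_mats (card C)"
    "\<And>a. a < card C \<Longrightarrow> h a \<in> C \<and> g (h a) = a" "\<And>i. i \<in> C \<Longrightarrow> g i < card C \<and> h (g i) = i"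
    "\<And>a b. a < card C \<Longrightarrow> b < card C \<Longrightarrow> class_mat A C $$ (a, b) = A $$ (h a, h b)"
proof -
  have Ac: "A \<in> carrier_mat n n" and nn: "\<And>i j. i < n \<Longrightarrow> j < n \<Longrightarrow> 0 \<le> A $$ (i, j)"
    using A by (auto simp: nonneg_mats_def)
  have fin: "finite C" using C finite_subset by blast
  have eq: "{i. i < n \<and> i \<in> C} = C" using C by auto
  have dim: "class_mat A C \<in> carrier_mat (card C) (card C)"
    using Ac by (intro carrier_matI) (auto simp: class_mat_def dim_submatrix eq)
  have h: "pick C a \<in> C" if "a < card C" for a using that pick_in_set_le by blast
  define g where "g i = card {a \<in> C. a < i}" for i
  have gh: "g (pick C a) = a" if "a < card C" for a
    using card_pick_le[OF that] by (simp add: g_def)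
  have hg: "pick C (g i) = i" if "i \<in> C" for i using pick_card_in_set[OF that] by (simp add: g_def)
  have g: "g i < card C" if "i \<in> C" for i
    unfolding g_def using that fin by (intro psubset_card_mono) auto
  have ent: "class_mat A C $$ (a, b) = A $$ (pick C a, pick C b)" if "a < card C" "b < card C" for a b
    unfolding class_mat_def using that Ac by (intro submatrix_index) (auto simp: eq)
  have "class_mat A C \<in> nonneg_mats (card C)"
    using dim ent nn h C by (auto simp: nonneg_mats_def subset_eq)
  then show ?thesis using that[of "pick C" g] h gh hg g ent by blast
qed

lemma class_mat_nonneg:
  assumes "A \<in> nonneg_mats n" "C \<subseteq> {..<n}"
  shows "class_mat A C \<in> nonneg_mats (card C)"
  using class_mat_reindex[OF assms] by blast

lemma class_mu_le_imp_potential: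
  assumes A: "A \<in> nonneg_mats n" and C: "C \<subseteq> {..<n}" and a: "0 < a" "mu (class_mat A C) \<le> a"
  shows "\<exists>x. (\<forall>i. 0 < x i) \<and> (\<forall>i\<in>C. \<forall>j\<in>C. A $$ (i, j) * x j \<le> a * x i)"
proof (rule class_mat_reindex[OF A C])
  fix h g
  assume h: "class_mat A C \<in> nonneg_mats (card C)"
    "\<And>a. a < card C \<Longrightarrow> h a \<in> C \<and> g (h a) = a" "\<And>i. i \<in> C \<Longrightarrow> g i < card C \<and> h (g i) = i"
    "\<And>a b. a < card C \<Longrightarrow> b < card C \<Longrightarrow> class_mat A C $$ (a, b) = A $$ (h a, h b)"
  obtain x where x: "\<forall>i. 0 < x i"
    "\<forall>i<card C. \<forall>j<card C. class_mat A C $$ (i, j) * x j \<le> a * x i"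
    using mu_le_imp_potential[OF h(1) a] by blast
  show ?thesis
  proof (intro exI[of _ "\<lambda>i. x (g i)"] conjI allI ballI)
    fix i j assume "i \<in> C" "j \<in> C"
    then show "A $$ (i, j) * x (g j) \<le> a * x (g i)" using x(2) h(3,4) by metis
  qed (use x in auto)
qed

lemma class_mu_le:
  assumes A: "A \<in> nonneg_mats n" and C: "C \<subseteq> {..<n}" and a: "0 \<le> a" and x: "\<And>i. 0 < x i"
    "\<And>i j. i \<in> C \<Longrightarrow> j \<in> C \<Longrightarrow> A $$ (i, j) * x j \<le> a * x i"
  shows "mu (class_mat A C) \<le> a"
proof (rule class_mat_reindex[OF A C])
  fix h g
  assume h: "class_mat A C \<in> nonneg_mats (card C)"
    "\<And>a. a < card C \<Longrightarrow> h a \<in> C \<and> g (h a) = a" "\<And>i. i \<in> C \<Longrightarrow> g i < card C \<and> h (g i) = i"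
    "\<And>a b. a < card C \<Longrightarrow> b < card C \<Longrightarrow> class_mat A C $$ (a, b) = A $$ (h a, h b)"
  show ?thesis
    using h x by (intro mu_le[OF h(1) a, where x = "\<lambda>i. x (h i)"]) auto
qed

lemma class_nu_potential:
  assumes A: "A \<in> nonneg_mats n" and C: "C \<subseteq> {..<n}" and c: "has_cycle (class_mat A C)"
  shows "\<exists>x. (\<forall>i. 0 < x i) \<and>
    (\<forall>i\<in>C. \<forall>j\<in>C. A $$ (i, j) \<noteq> 0 \<longrightarrow> nu (class_mat A C) * x i \<le> A $$ (i, j) * x j)"
proof (rule class_mat_reindex[OF A C])
  fix h g
  assume h: "class_mat A C \<in> nonneg_mats (card C)"
    "\<And>a. a < card C \<Longrightarrow> h a \<in> C \<and> g (h a) = a" "\<And>i. i \<in> C \<Longrightarrow> g i < card C \<and> h (g i) = i"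
    "\<And>a b. a < card C \<Longrightarrow> b < card C \<Longrightarrow> class_mat A C $$ (a, b) = A $$ (h a, h b)"
  obtain x where x: "\<forall>i. 0 < x i"
    "\<forall>i<card C. \<forall>j<card C. class_mat A C $$ (i, j) \<noteq> 0 \<longrightarrow>
      nu (class_mat A C) * x i \<le> class_mat A C $$ (i, j) * x j"
    using nu_potential[OF h(1) c] by blast
  show ?thesis
  proof (intro exI[of _ "\<lambda>i. x (g i)"] conjI allI ballI impI)
    fix i j assume "i \<in> C" "j \<in> C" "A $$ (i, j) \<noteq> 0"
    then show "nu (class_mat A C) * x (g i) \<le> A $$ (i, j) * x (g j)" using x(2) h(3,4) by metis
  qed (use x in auto)
qed

lemma le_class_nu:
  assumes A: "A \<in> nonneg_mats n" and C: "C \<subseteq> {..<n}" and c: "has_cycle (class_mat A C)"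
    and x: "\<And>i. 0 < x i"
    "\<And>i j. i \<in> C \<Longrightarrow> j \<in> C \<Longrightarrow> A $$ (i, j) \<noteq> 0 \<Longrightarrow> a * x i \<le> A $$ (i, j) * x j"
  shows "a \<le> nu (class_mat A C)"
proof (rule class_mat_reindex[OF A C])
  fix h g
  assume h: "class_mat A C \<in> nonneg_mats (card C)"
    "\<And>a. a < card C \<Longrightarrow> h a \<in> C \<and> g (h a) = a" "\<And>i. i \<in> C \<Longrightarrow> g i < card C \<and> h (g i) = i"
    "\<And>a b. a < card C \<Longrightarrow> b < card C \<Longrightarrow> class_mat A C $$ (a, b) = A $$ (h a, h b)"
  show ?thesis
    using h x by (intro le_nu[OF h(1) c, where x = "\<lambda>i. x (h i)"]) auto
qed

lemma class_nu_tight: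
  assumes A: "A \<in> nonneg_mats n" and C: "C \<subseteq> {..<n}" and c: "has_cycle (class_mat A C)"
  shows "\<exists>K x. K \<noteq> {} \<and> K \<subseteq> C \<and> (\<forall>i. 0 < x i) \<and>
    (\<forall>i\<in>K. \<exists>j\<in>K. A $$ (i, j) \<noteq> 0 \<and> A $$ (i, j) * x j = nu (class_mat A C) * x i)"
proof (rule class_mat_reindex[OF A C])
  fix h g
  assume h: "class_mat A C \<in> nonneg_mats (card C)"
    "\<And>a. a < card C \<Longrightarrow> h a \<in> C \<and> g (h a) = a" "\<And>i. i \<in> C \<Longrightarrow> g i < card C \<and> h (g i) = i"
    "\<And>a b. a < card C \<Longrightarrow> b < card C \<Longrightarrow> class_mat A C $$ (a, b) = A $$ (h a, h b)"
  obtain K x where K: "K \<noteq> {}" "K \<subseteq> {..<card C}" "\<forall>i. 0 < x i"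
    "\<forall>i\<in>K. \<exists>j\<in>K. class_mat A C $$ (i, j) \<noteq> 0
      \<and> class_mat A C $$ (i, j) * x j = nu (class_mat A C) * x i"
    using nu_tight[OF h(1) c] by blast
  have "\<exists>j\<in>h ` K. A $$ (h i, j) \<noteq> 0 \<and> A $$ (h i, j) * x (g j) = nu (class_mat A C) * x (g (h i))"
    if i: "i \<in> K" for i
  proof -
    obtain j where j: "j \<in> K" "class_mat A C $$ (i, j) \<noteq> 0"
      "class_mat A C $$ (i, j) * x j = nu (class_mat A C) * x i" using K(4) i by blast
    have "i < card C" "j < card C" using i j K(2) by auto
    then show ?thesis using j h by (intro bexI[of _ "h j"]) auto
  qed
  moreover have "h ` K \<subseteq> C" using K h by auto
  ultimately show ?thesis using K(1,3) by (intro exI[of _ "h ` K"] exI[of _ "\<lambda>i. x (g i)"]) auto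
qed

lemma class_has_cycleI:
  assumes A: "A \<in> nonneg_mats n" and C: "C \<subseteq> {..<n}" and K: "K \<noteq> {}" "K \<subseteq> C"
    "\<And>i. i \<in> K \<Longrightarrow> \<exists>j\<in>K. A $$ (i, j) \<noteq> 0"
  shows "has_cycle (class_mat A C)"
proof (rule class_mat_reindex[OF A C])
  fix h g
  assume h: "class_mat A C \<in> nonneg_mats (card C)"
    "\<And>a. a < card C \<Longrightarrow> h a \<in> C \<and> g (h a) = a" "\<And>i. i \<in> C \<Longrightarrow> g i < card C \<and> h (g i) = i"
    "\<And>a b. a < card C \<Longrightarrow> b < card C \<Longrightarrow> class_mat A C $$ (a, b) = A $$ (h a, h b)"
  show ?thesis
  proof (rule has_cycleI[OF h(1), of "g ` K"])
    fix a assume "a \<in> g ` K"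
    then obtain i where i: "i \<in> K" "a = g i" by auto
    then obtain j where j: "j \<in> K" "A $$ (i, j) \<noteq> 0" using K(3) by blast
    have "i \<in> C" "j \<in> C" using i j K by auto
    then show "\<exists>b\<in>g ` K. class_mat A C $$ (a, b) \<noteq> 0"
      using h(3,4) i j by (intro bexI[of _ "g j"]) auto
  qed (use K h in auto)
qed

text \<open>Shows that a trivial class cannot attain a positive minimum, so that restricting to
  nontrivial classes changes nothing when \<open>m > 0\<close>.\<close>

lemma trivial_class_nu: "trivial_class B C \<Longrightarrow> nu (class_mat B C) = 0"
proof -
  assume "trivial_class B C"
  then have eq: "class_mat B C = 0\<^sub>m 1 1" by (simp add: trivial_class_def)
  have "\<not> has_cycle (0\<^sub>m 1 1)"
  proof
    have "arcs (mat_digraph (0\<^sub>m 1 1)) = {}"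
      by (auto simp: mat_digraph_def intro!: gr0I)
    moreover assume "has_cycle (0\<^sub>m 1 1)"
    ultimately show False by (auto simp: pre_digraph.cycle_def pre_digraph.awalk_def)
  qed
  then show ?thesis using acyclic_mu_nu by (simp add: eq)
qed

subsection \<open>Matrices with a given auxiliary matrix\<close>

locale row_uniform_matrix =
  fixes B :: "real mat" and n :: nat
  assumes n_pos: "0 < n" and B_nonneg: "B \<in> nonneg_mats n" and B_uniform: "row_uniform B"
begin

sublocale G: fin_digraph "mat_digraph B"
  by (rule fin_digraph_mat_digraph[OF B_nonneg])

lemma dim_B [simp]: "dim_row B = n" "dim_col B = n"
  using B_nonneg by (auto simp: nonneg_mats_def)

lemmas arcs_G = arcs_mat_digraph[OF B_nonneg]

definition supp :: "nat \<Rightarrow> nat set" where "supp i = {j. j < n \<and> B $$ (i, j) \<noteq> 0}"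

lemma finite_supp [simp]: "finite (supp i)"
  by (simp add: supp_def)

lemma supp_pos: "i < n \<Longrightarrow> j \<in> supp i \<Longrightarrow> 0 < B $$ (i, j)"
  using B_nonneg by (auto simp: supp_def nonneg_mats_def less_le)

lemma B_eq_0: "j < n \<Longrightarrow> j \<notin> supp i \<Longrightarrow> B $$ (i, j) = 0"
  by (simp add: supp_def)

lemma supp_eq: "i < n \<Longrightarrow> j \<in> supp i \<Longrightarrow> k \<in> supp i \<Longrightarrow> B $$ (i, j) = B $$ (i, k)"
  using B_uniform by (auto simp: supp_def row_uniform_def)

text \<open>Values off the support are left free, as \<open>wmat\<close> multiplies them by 0; zero
  rows are exempt because an empty sum cannot be 1.\<close>

definition row_weights :: "(nat \<Rightarrow> nat \<Rightarrow> real) set" where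
  "row_weights = {p. \<forall>i<n. (\<forall>j\<in>supp i. 0 < p i j) \<and> (supp i \<noteq> {} \<longrightarrow> sum (p i) (supp i) = 1)}"

definition wmat :: "(nat \<Rightarrow> nat \<Rightarrow> real) \<Rightarrow> real mat" where
  "wmat p = mat n n (\<lambda>(i, j). B $$ (i, j) * p i j)"

text \<open>Row \<open>i\<close> of \<open>wmat p\<close> applied to \<open>x\<close>, grouped as an
  average of the values \<open>B $$ (i, j) * x j\<close>, so that inequalities on arcs pass to it
  directly.\<close>

definition act :: "(nat \<Rightarrow> nat \<Rightarrow> real) \<Rightarrow> (nat \<Rightarrow> real) \<Rightarrow> nat \<Rightarrow> real" where
  "act p x i = (\<Sum>j\<in>supp i. p i j * (B $$ (i, j) * x j))"

lemma row_weightsD: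
  assumes "p \<in> row_weights" "i < n"
  shows "\<And>j. j \<in> supp i \<Longrightarrow> 0 < p i j" "supp i \<noteq> {} \<Longrightarrow> sum (p i) (supp i) = 1"
  using assms by (auto simp: row_weights_def)

lemma sum_wmat:
  assumes "i < n"
  shows "(\<Sum>j<n. wmat p $$ (i, j) * x j) = act p x i"
proof -
  have "(\<Sum>j<n. wmat p $$ (i, j) * x j) = (\<Sum>j<n. p i j * (B $$ (i, j) * x j))"
    using assms by (intro sum.cong) (auto simp: wmat_def)
  also have "\<dots> = act p x i"
    unfolding act_def by (intro sum.mono_neutral_right) (auto simp: supp_def)
  finally show ?thesis .
qed

lemma wmat_nonneg:
  assumes "p \<in> row_weights"
  shows "wmat p \<in> nonneg_mats n"
proof -
  have "0 \<le> B $$ (i, j) * p i j" if "i < n" "j < n" for i j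
  proof (cases "j \<in> supp i")
    case True
    then show ?thesis using supp_pos[OF that(1) True] row_weightsD(1)[OF assms that(1) True] by simp
  qed (simp add: B_eq_0 that)
  then show ?thesis by (auto simp: nonneg_mats_def wmat_def)
qed

lemma Aux_wmat:
  assumes p: "p \<in> row_weights"
  shows "Aux (wmat p) = B"
proof (rule eq_matI)
  fix i j assume "i < dim_row B" "j < dim_col B"
  then have ij: "i < n" "j < n" by auto
  show "Aux (wmat p) $$ (i, j) = B $$ (i, j)"
  proof (cases "j \<in> supp i")
    case True
    have "(\<Sum>k<n. wmat p $$ (i, k)) = act p (\<lambda>_. 1) i" using sum_wmat[OF ij(1), of p "\<lambda>_. 1"] by simp
    also have "\<dots> = (\<Sum>k\<in>supp i. p i k * B $$ (i, j))"
      unfolding act_def using supp_eq[OF ij(1) True] by (intro sum.cong) auto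
    also have "\<dots> = B $$ (i, j)"
      using row_weightsD(2)[OF p ij(1)] True by (auto simp flip: sum_distrib_right)
    finally have "(\<Sum>k<n. wmat p $$ (i, k)) = B $$ (i, j)" .
    moreover have "wmat p $$ (i, j) \<noteq> 0"
      using row_weightsD(1)[OF p ij(1) True] supp_pos[OF ij(1) True] ij by (simp add: wmat_def)
    ultimately show ?thesis using ij by (simp add: Aux_def wmat_def)
  next
    case False
    then show ?thesis using ij by (simp add: Aux_def wmat_def B_eq_0)
  qed
qed (auto simp: Aux_def wmat_def)

text \<open>The weights are recovered as quotients of entries of \<open>A\<close> and
  \<open>B\<close>. By row uniformity all denominators in a row agree and equal the row sum of
  \<open>A\<close>, so the weights sum to 1.\<close>

lemma eta_eq: "eta B = (\<lambda>p. rho (wmat p)) ` row_weights"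
proof
  show "(\<lambda>p. rho (wmat p)) ` row_weights \<subseteq> eta B"
    using wmat_nonneg Aux_wmat by (auto simp: eta_def)
  show "eta B \<subseteq> (\<lambda>p. rho (wmat p)) ` row_weights"
  proof
    fix r assume "r \<in> eta B"
    then obtain A where A: "r = rho A" "A \<in> nonneg_mats n" "Aux A = B" by (auto simp: eta_def)
    then have Ac: "A \<in> carrier_mat n n" and nn: "\<And>i j. i < n \<Longrightarrow> j < n \<Longrightarrow> 0 \<le> A $$ (i, j)"
      by (auto simp: nonneg_mats_def)
    have B: "B $$ (i, j) = (if A $$ (i, j) \<noteq> 0 then \<Sum>k<n. A $$ (i, k) else 0)"
      if "i < n" "j < n" for i j
      using that Ac by (subst A(3)[symmetric]) (simp add: Aux_def)
    \<comment> \<open>Nonnegative entries cannot cancel in a row sum, so \<open>A\<close> and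
      \<open>B\<close> have the same support.\<close>
    have nz: "B $$ (i, j) \<noteq> 0 \<longleftrightarrow> A $$ (i, j) \<noteq> 0" if "i < n" "j < n" for i j
    proof -
      have "0 < (\<Sum>k<n. A $$ (i, k))" if "A $$ (i, j) \<noteq> 0"
        using that nn \<open>i < n\<close> \<open>j < n\<close> by (intro sum_pos2[of _ j]) (auto simp: less_le)
      then show ?thesis using B[OF that] by auto
    qed
    define p where "p i j = A $$ (i, j) / B $$ (i, j)" for i j
    have "wmat p = A"
      using Ac nz by (intro eq_matI) (auto simp: wmat_def p_def)
    moreover have "p \<in> row_weights"
      unfolding row_weights_def
    proof (intro CollectI allI impI conjI ballI)
      fix i assume i: "i < n"
      show "0 < p i j" if j: "j \<in> supp i" for j
      proof -
        have "j < n" "A $$ (i, j) \<noteq> 0" using j nz i by (auto simp: supp_def)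
        then have "0 < A $$ (i, j)" using nn[OF i, of j] by simp
        then show ?thesis unfolding p_def using supp_pos[OF i j] by simp
      qed
      assume "supp i \<noteq> {}"
      then obtain j where j: "j \<in> supp i" by auto
      have "sum (p i) (supp i) = (\<Sum>k\<in>supp i. A $$ (i, k)) / B $$ (i, j)"
        unfolding sum_divide_distrib p_def using supp_eq[OF i j] by (intro sum.cong) auto
      also have "(\<Sum>k\<in>supp i. A $$ (i, k)) = (\<Sum>k<n. A $$ (i, k))"
        using nz i by (intro sum.mono_neutral_left) (auto simp: supp_def)
      also have "\<dots> = B $$ (i, j)" using B[OF i, of j] nz[OF i, of j] j by (auto simp: supp_def)
      finally show "sum (p i) (supp i) = 1" using supp_pos[OF i j] by simp
    qed
    ultimately show "r \<in> (\<lambda>p. rho (wmat p)) ` row_weights" using A(1) by blast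
  qed
qed

lemma act_le:
  assumes p: "p \<in> row_weights" and i: "i < n" and c: "0 \<le> c"
    and le: "\<And>j. j \<in> supp i \<Longrightarrow> B $$ (i, j) * x j \<le> c"
  shows "act p x i \<le> c"
proof (cases "supp i = {}")
  case False
  have "act p x i \<le> (\<Sum>j\<in>supp i. p i j * c)"
    unfolding act_def using le row_weightsD(1)[OF p i] by (intro sum_mono mult_left_mono) (auto simp: less_imp_le)
  also have "\<dots> = c" using row_weightsD(2)[OF p i False] by (simp flip: sum_distrib_right)
  finally show ?thesis .
qed (use c in \<open>simp add: act_def\<close>)

lemma act_ge:
  assumes p: "p \<in> row_weights" and i: "i < n" and ne: "supp i \<noteq> {}"
    and le: "\<And>j. j \<in> supp i \<Longrightarrow> c \<le> B $$ (i, j) * x j"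
  shows "c \<le> act p x i"
proof -
  have "c = (\<Sum>j\<in>supp i. p i j * c)"
    using row_weightsD(2)[OF p i ne] by (simp flip: sum_distrib_right)
  also have "\<dots> \<le> act p x i"
    unfolding act_def using le row_weightsD(1)[OF p i] by (intro sum_mono mult_left_mono) (auto simp: less_imp_le)
  finally show ?thesis .
qed

text \<open>The deviations from \<open>c\<close> have one sign and a vanishing weighted sum; as all
  weights on the support are strictly positive, each deviation is 0. Equality for a row thereby
  becomes equality on every arc, the key to both endpoint criteria.\<close>

lemma act_eq_imp_eq:
  assumes p: "p \<in> row_weights" and i: "i < n" and ne: "supp i \<noteq> {}" and j: "j \<in> supp i"
    and le: "(\<forall>j\<in>supp i. B $$ (i, j) * x j \<le> c) \<or> (\<forall>j\<in>supp i. c \<le> B $$ (i, j) * x j)"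
    and eq: "act p x i = c"
  shows "B $$ (i, j) * x j = c"
proof -
  define t where "t j = p i j * (B $$ (i, j) * x j - c)" for j
  have "(\<Sum>j\<in>supp i. t j) = act p x i - (\<Sum>j\<in>supp i. p i j * c)"
    by (simp add: t_def act_def right_diff_distrib sum_subtractf)
  also have "\<dots> = 0" using row_weightsD(2)[OF p i ne] eq by (simp flip: sum_distrib_right)
  finally have s: "(\<Sum>j\<in>supp i. t j) = 0" .
  have "t j = 0"
    using le
  proof
    assume "\<forall>j\<in>supp i. B $$ (i, j) * x j \<le> c"
    then have "\<And>j. j \<in> supp i \<Longrightarrow> 0 \<le> - t j"
      using row_weightsD(1)[OF p i] by (auto simp: t_def mult_le_0_iff less_imp_le)
    then show ?thesis
      using s j sum_nonneg_eq_0_iff[of "supp i" "\<lambda>j. - t j"] by (simp add: sum_negf)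
  next
    assume "\<forall>j\<in>supp i. c \<le> B $$ (i, j) * x j"
    then have "\<And>j. j \<in> supp i \<Longrightarrow> 0 \<le> t j"
      using row_weightsD(1)[OF p i] by (auto simp: t_def less_imp_le)
    then show ?thesis using s j sum_nonneg_eq_0_iff[of "supp i" t] by simp
  qed
  then show ?thesis using row_weightsD(1)[OF p i j] by (simp add: t_def)
qed

lemma ex_row_weights:
  assumes "\<And>i. i < n \<Longrightarrow> supp i \<noteq> {} \<Longrightarrow> (\<forall>j\<in>supp i. g i j \<le> L i) \<or> (\<exists>j\<in>supp i. g i j < L i)"
  shows "\<exists>p\<in>row_weights. \<forall>i<n. supp i \<noteq> {} \<longrightarrow> (\<Sum>j\<in>supp i. p i j * g i j) \<le> (L i :: real)"
proof -
  have "\<exists>q. i < n \<longrightarrow> supp i \<noteq> {} \<longrightarrow>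
      (\<forall>j\<in>supp i. 0 < q j) \<and> sum q (supp i) = 1 \<and> (\<Sum>j\<in>supp i. q j * g i j) \<le> L i" for i
  proof (cases "i < n \<and> supp i \<noteq> {}")
    case True
    then show ?thesis using ex_weights_le[OF finite_supp, of i "g i" "L i"] assms[of i] by auto
  qed auto
  then obtain p where p: "\<And>i. i < n \<Longrightarrow> supp i \<noteq> {} \<Longrightarrow>
      (\<forall>j\<in>supp i. 0 < p i j) \<and> sum (p i) (supp i) = 1 \<and> (\<Sum>j\<in>supp i. p i j * g i j) \<le> L i"
    by metis
  then have "p \<in> row_weights" unfolding row_weights_def by blast
  then show ?thesis using p by blast
qed

lemma rho_wmat_le:
  assumes p: "p \<in> row_weights" and x: "\<And>i. 0 < x i" "\<And>i. i < n \<Longrightarrow> act p x i \<le> c * x i"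
  shows "rho (wmat p) \<le> c"
  using rho_le[OF wmat_nonneg[OF p] n_pos, of x c] x by (simp add: sum_wmat)

lemma sum_wmat_subset:
  assumes "i < n" "K \<subseteq> {..<n}"
  shows "(\<Sum>j\<in>K. wmat p $$ (i, j) * w j) = act p (\<lambda>j. if j \<in> K then w j else 0) i"
proof -
  have "(\<Sum>j<n. wmat p $$ (i, j) * (if j \<in> K then w j else 0)) = (\<Sum>j\<in>K. wmat p $$ (i, j) * w j)"
    using assms by (intro sum.mono_neutral_cong_right) auto
  then show ?thesis using sum_wmat[OF assms(1)] by metis
qed

lemma act_nonneg:
  assumes p: "p \<in> row_weights" and i: "i < n" and x: "\<And>i. 0 \<le> x i"
  shows "0 \<le> act p x i"
  unfolding act_def using x row_weightsD(1)[OF p i] supp_pos[OF i]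
  by (intro sum_nonneg mult_nonneg_nonneg) (auto simp: less_imp_le)

lemma le_rho_wmat:
  assumes p: "p \<in> row_weights" and K: "K \<noteq> {}" "K \<subseteq> {..<n}" and w: "\<And>i. i \<in> K \<Longrightarrow> 0 < w i"
    "\<And>i. i \<in> K \<Longrightarrow> c * w i \<le> act p (\<lambda>j. if j \<in> K then w j else 0) i"
  shows "c \<le> rho (wmat p)"
proof -
  define v where "v j = (if j \<in> K then w j else 0)" for j
  obtain k where k: "k \<in> K" using K by auto
  have v0: "0 \<le> v i" for i using w(1)[of i] by (auto simp: v_def)
  show ?thesis
  proof (rule rho_ge[OF wmat_nonneg[OF p] n_pos, of v k])
    show "k < n" "0 < v k" using k K w by (auto simp: v_def)
    show "0 \<le> v i" for i by (rule v0)
    fix i assume i: "i < n"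
    show "c * v i \<le> (\<Sum>j<n. wmat p $$ (i, j) * v j)"
    proof (cases "i \<in> K")
      case True
      then show ?thesis unfolding sum_wmat[OF i] using w(2)[OF True] by (simp add: v_def)
    next
      case False
      then show ?thesis unfolding sum_wmat[OF i] using act_nonneg[OF p i v0] by (simp add: v_def)
    qed
  qed
qed

lemma less_rho_wmat:
  assumes p: "p \<in> row_weights" and K: "K \<noteq> {}" "K \<subseteq> {..<n}" and w: "\<And>i. i \<in> K \<Longrightarrow> 0 < w i"
    "\<And>i. i \<in> K \<Longrightarrow> c * w i < act p (\<lambda>j. if j \<in> K then w j else 0) i"
  shows "c < rho (wmat p)"
proof (rule rho_gt[OF wmat_nonneg[OF p] n_pos K])
  show "c * w i < (\<Sum>j\<in>K. wmat p $$ (i, j) * w j)" if "i \<in> K" for i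
    using w(2)[OF that] sum_wmat_subset[of i K p w] that K by auto
qed (rule w(1))

subsection \<open>Final classes\<close>

lemma arc_iff: "i \<rightarrow>\<^bsub>mat_digraph B\<^esub> j \<longleftrightarrow> i < n \<and> j \<in> supp i"
proof -
  have "i \<rightarrow>\<^bsub>mat_digraph B\<^esub> j \<longleftrightarrow> (\<exists>e\<in>arcs (mat_digraph B). fst e = i \<and> snd e = j)"
    by (force simp: arcs_ends_def arc_to_ends_def)
  also have "\<dots> \<longleftrightarrow> i < n \<and> j \<in> supp i" by (auto simp: arcs_G supp_def)
  finally show ?thesis .
qed

lemma reachable_closed:
  assumes "u \<rightarrow>\<^sup>*\<^bsub>mat_digraph B\<^esub> v" "u \<in> D" "\<And>i. i \<in> D \<Longrightarrow> supp i \<subseteq> D"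
  shows "v \<in> D"
  using assms(1,2)
proof (induction rule: G.reachable_induct)
  case base
  then show ?case by simp
next
  case (step x y)
  then show ?case using assms(3)[of x] arc_iff[of x y] by auto
qed

text \<open>The combinatorial content of finality: these sets are closed under arcs, and minimal
  among nonempty closed sets, because from any node of \<open>C\<close> all of \<open>C\<close> is
  reachable.\<close>

lemma final_classD:
  assumes C: "C \<in> final_classes B"
  shows "C \<noteq> {}" "C \<subseteq> {..<n}" "\<And>i. i \<in> C \<Longrightarrow> supp i \<subseteq> C"
    "\<And>D. D \<noteq> {} \<Longrightarrow> D \<subseteq> C \<Longrightarrow> (\<And>i. i \<in> D \<Longrightarrow> supp i \<subseteq> D) \<Longrightarrow> D = C"
proof -
  have sc: "C \<in> G.sccs_verts" using C by (simp add: final_classes_def)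
  then show "C \<noteq> {}" by (simp add: G.in_sccs_verts_conv_reachable)
  show sub: "C \<subseteq> {..<n}" using G.sccs_verts_subsets[OF sc] by auto
  show "supp i \<subseteq> C" if i: "i \<in> C" for i
  proof
    fix j assume j: "j \<in> supp i"
    show "j \<in> C"
    proof (rule ccontr)
      assume nj: "j \<notin> C"
      have "j \<in> verts (mat_digraph B)" using j by (simp add: supp_def)
      then have "G.scc_of j \<in> G.sccs_verts" "j \<in> G.scc_of j"
        using G.scc_of_in_sccs_verts G.in_scc_of_self by blast+
      moreover have "(i, j) \<in> arcs (mat_digraph B)" using i j sub by (auto simp: arcs_G supp_def)
      ultimately show False using C nj i unfolding final_classes_def by blast
    qed
  qed
  show "D = C" if D: "D \<noteq> {}" "D \<subseteq> C" "\<And>i. i \<in> D \<Longrightarrow> supp i \<subseteq> D" for D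
  proof
    obtain u where u: "u \<in> D" using D by auto
    show "C \<subseteq> D"
    proof
      fix v assume "v \<in> C"
      then have "u \<rightarrow>\<^sup>*\<^bsub>mat_digraph B\<^esub> v" using sc u D(2) by (auto simp: G.in_sccs_verts_conv_reachable)
      then show "v \<in> D" using reachable_closed u D(3) by blast
    qed
  qed fact
qed

text \<open>A minimal nonempty closed subset works: the set reachable from one of its nodes is again
  closed, hence is the whole subset, which is therefore strongly connected.\<close>

lemma ex_final_class_subset:
  assumes D: "D \<noteq> {}" "D \<subseteq> {..<n}" "\<And>i. i \<in> D \<Longrightarrow> supp i \<subseteq> D"
  shows "\<exists>C\<in>final_classes B. C \<subseteq> D"
proof -
  define P where "P S \<longleftrightarrow> S \<noteq> {} \<and> S \<subseteq> D \<and> (\<forall>i\<in>S. supp i \<subseteq> S)" for S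
  have "finite {S. P S}"
    by (rule finite_subset[of _ "Pow {..<n}"]) (use D in \<open>auto simp: P_def\<close>)
  moreover have "P D" using D by (auto simp: P_def)
  ultimately obtain C where C: "P C" and min: "\<And>S. P S \<Longrightarrow> S \<subseteq> C \<Longrightarrow> S = C"
    using finite_has_minimal2[of "{S. P S}" D] by auto
  have sub: "C \<subseteq> {..<n}" using C D by (auto simp: P_def)
  have reach: "u \<rightarrow>\<^sup>*\<^bsub>mat_digraph B\<^esub> v" if u: "u \<in> C" and v: "v \<in> C" for u v
  proof -
    define R where "R = {w. u \<rightarrow>\<^sup>*\<^bsub>mat_digraph B\<^esub> w}"
    have "R \<subseteq> C" using C reachable_closed[of u _ C] u by (auto simp: R_def P_def)
    moreover have "u \<in> R" using u sub by (auto simp: R_def)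
    moreover have "supp i \<subseteq> R" if "i \<in> R" for i
    proof
      fix j assume "j \<in> supp i"
      moreover have "i < n" using that \<open>R \<subseteq> C\<close> sub by auto
      ultimately have "i \<rightarrow>\<^bsub>mat_digraph B\<^esub> j" by (simp add: arc_iff)
      then show "j \<in> R" using that G.reachable_adj_trans by (auto simp: R_def)
    qed
    ultimately have "P R" using C by (auto simp: P_def)
    then have "R = C" using min \<open>R \<subseteq> C\<close> by blast
    then show ?thesis using v by (auto simp: R_def)
  qed
  have closed: "v \<in> C" if "u \<in> C" "u \<rightarrow>\<^sup>*\<^bsub>mat_digraph B\<^esub> v" for u v
    using reachable_closed[OF that(2,1)] C by (auto simp: P_def)
  have sc: "C \<in> G.sccs_verts"
    using C reach closed unfolding G.in_sccs_verts_conv_reachable P_def by blast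
  have "C \<in> final_classes B"
    unfolding final_classes_def
  proof (intro CollectI conjI sc notI)
    assume "\<exists>D\<in>G.sccs_verts. D \<noteq> C \<and> (\<exists>(i, j)\<in>arcs (mat_digraph B). i \<in> C \<and> j \<in> D)"
    then obtain E i j where E: "E \<in> G.sccs_verts" "E \<noteq> C" "(i, j) \<in> arcs (mat_digraph B)"
      "i \<in> C" "j \<in> E" by blast
    then have "j \<in> supp i" by (simp add: arcs_G supp_def)
    then have "j \<in> C" using C E by (auto simp: P_def)
    then show False using G.sccs_verts_disjoint[OF E(1) sc E(2)] E(5) by blast
  qed
  then show ?thesis using C by (auto simp: P_def)
qed

lemma final_classes_finite_ne: "finite (final_classes B)" "final_classes B \<noteq> {}"
proof -
  show "finite (final_classes B)"
    by (rule finite_subset[of _ "Pow {..<n}"]) (use final_classD in auto)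
  show "final_classes B \<noteq> {}"
    using ex_final_class_subset[of "{..<n}"] n_pos by (auto simp: supp_def)
qed

text \<open>If no row of \<open>C\<close> vanishes, closedness lets one step inside \<open>C\<close>
  forever, which gives a cycle. A zero row is a closed set by itself and fills \<open>C\<close> by
  minimality.\<close>

lemma final_class_cases:
  assumes C: "C \<in> final_classes B"
  shows "(has_cycle (class_mat B C) \<and> (\<forall>i\<in>C. supp i \<noteq> {})) \<or>
    (\<not> has_cycle (class_mat B C) \<and> (\<exists>i. C = {i} \<and> supp i = {}))"
proof (cases "\<forall>i\<in>C. supp i \<noteq> {}")
  case True
  have "has_cycle (class_mat B C)"
  proof (rule class_has_cycleI[OF B_nonneg final_classD(2)[OF C] final_classD(1)[OF C]])
    fix i assume i: "i \<in> C"
    then obtain j where "j \<in> supp i" using True by blast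
    then show "\<exists>j\<in>C. B $$ (i, j) \<noteq> 0" using final_classD(3)[OF C i] by (auto simp: supp_def)
  qed simp
  then show ?thesis using True by blast
next
  case False
  then obtain i where i: "i \<in> C" "supp i = {}" by blast
  then have Ci: "C = {i}" using final_classD(4)[OF C, of "{i}"] by simp
  moreover have "\<not> has_cycle (class_mat B C)"
  proof
    assume c: "has_cycle (class_mat B C)"
    obtain K x where K: "K \<noteq> {}" "K \<subseteq> C" "\<forall>i. 0 < x i"
      "\<forall>i\<in>K. \<exists>j\<in>K. B $$ (i, j) \<noteq> 0 \<and> B $$ (i, j) * x j = nu (class_mat B C) * x i"
      using class_nu_tight[OF B_nonneg final_classD(2)[OF C] c] by blast
    then have "B $$ (i, i) \<noteq> 0" using Ci by auto
    then show False using i final_classD(2)[OF C] by (auto simp: supp_def)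
  qed
  ultimately show ?thesis using i by blast
qed

abbreviation nuC :: "nat set \<Rightarrow> real" where "nuC C \<equiv> nu (class_mat B C)"
abbreviation muC :: "nat set \<Rightarrow> real" where "muC C \<equiv> mu (class_mat B C)"

lemma nuC_bounds:
  assumes "C \<in> final_classes B"
  shows "0 \<le> nuC C" "nuC C \<le> muC C"
  by (rule nu_bounds[OF class_mat_nonneg[OF B_nonneg final_classD(2)[OF assms]]])+

lemma final_class_nu_potential:
  assumes C: "C \<in> final_classes B" "0 < nuC C"
  obtains x where "\<And>i. 0 < x i" "\<And>i. i \<in> C \<Longrightarrow> supp i \<noteq> {}"
    "\<And>i j. i \<in> C \<Longrightarrow> j \<in> supp i \<Longrightarrow> nuC C * x i \<le> B $$ (i, j) * x j"
proof -
  have c: "has_cycle (class_mat B C)" using acyclic_mu_nu[of "class_mat B C"] C(2) by auto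
  obtain x where x: "\<forall>i. 0 < x i"
    "\<forall>i\<in>C. \<forall>j\<in>C. B $$ (i, j) \<noteq> 0 \<longrightarrow> nuC C * x i \<le> B $$ (i, j) * x j"
    using class_nu_potential[OF B_nonneg final_classD(2)[OF C(1)] c] by blast
  show ?thesis
  proof (rule that[of x])
    show "supp i \<noteq> {}" if "i \<in> C" for i using final_class_cases[OF C(1)] c that by blast
    show "nuC C * x i \<le> B $$ (i, j) * x j" if "i \<in> C" "j \<in> supp i" for i j
      using x(2) that final_classD(3)[OF C(1) that(1)] by (auto simp: supp_def)
  qed (use x in auto)
qed

subsection \<open>Sunflower subgraphs\<close>

lemma sunflowerD:
  assumes H: "H \<in> sunflower_subgraphs (mat_digraph B)"
  shows "fin_digraph H" "arcs H \<subseteq> arcs (mat_digraph B)" "tail H = fst" "head H = snd"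
    "verts H = {0..<n}" "\<And>i. i < n \<Longrightarrow> supp i \<noteq> {} \<Longrightarrow> \<exists>j\<in>supp i. (i, j) \<in> arcs H"
proof -
  have sub: "subgraph H (mat_digraph B)" "verts H = {0..<n}"
    using H by (auto simp: sunflower_subgraphs_def spanning_def)
  then show 1: "arcs H \<subseteq> arcs (mat_digraph B)" "tail H = fst" "head H = snd" "verts H = {0..<n}"
    by (auto simp: subgraph_def compatible_def)
  show "fin_digraph H"
    using sub G.fin_digraph_subgraph by blast
  fix i assume i: "i < n" "supp i \<noteq> {}"
  then obtain j where "j \<in> supp i" by blast
  then have "(i, j) \<in> out_arcs (mat_digraph B) i" using i by (auto simp: out_arcs_def arcs_G supp_def)
  then have "out_arcs (mat_digraph B) i \<noteq> {}" by blast
  moreover have "i \<in> verts (mat_digraph B)" using i by simp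
  ultimately have "\<exists>!e. e \<in> out_arcs H i" using H unfolding sunflower_subgraphs_def by blast
  then obtain e where "e \<in> out_arcs H i" by blast
  then have "(i, snd e) \<in> arcs H" using 1 by (cases e) (auto simp: out_arcs_def)
  moreover then have "snd e \<in> supp i" using 1(1) by (auto simp: arcs_G supp_def)
  ultimately show "\<exists>j\<in>supp i. (i, j) \<in> arcs H" by blast
qed

lemma sunflower_weight_pos:
  assumes "H \<in> sunflower_subgraphs (mat_digraph B)" "e \<in> arcs H"
  shows "0 < mat_weight B e"
  using sunflowerD(2)[OF assms(1)] assms(2) mat_weight_pos[OF B_nonneg] by blast

lemma ex_sunflower:
  assumes f: "\<And>i. i < n \<Longrightarrow> supp i \<noteq> {} \<Longrightarrow> f i \<in> supp i"
  obtains H where "H \<in> sunflower_subgraphs (mat_digraph B)"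
    "arcs H = {(i, f i) | i. i < n \<and> supp i \<noteq> {}}"
proof
  define H where "H = mat_digraph B\<lparr>arcs := {(i, f i) | i. i < n \<and> supp i \<noteq> {}}\<rparr>"
  show arcs: "arcs H = {(i, f i) | i. i < n \<and> supp i \<noteq> {}}" by (simp add: H_def)
  have fn: "f i < n \<and> f i \<in> supp i" if "i < n" "j \<in> supp i" for i j
    using f[of i] that by (auto simp: supp_def)
  have "wf_digraph H" by unfold_locales (use fn in \<open>auto simp: H_def\<close>)
  moreover have "arcs H \<subseteq> arcs (mat_digraph B)"
    using fn unfolding arcs arcs_G by (auto simp: supp_def)
  ultimately have "spanning H (mat_digraph B)"
    by (auto simp: spanning_def subgraph_def compatible_def G.wf_digraph_axioms) (auto simp: H_def)
  moreover have "\<exists>!e. e \<in> out_arcs H i" if "i \<in> verts (mat_digraph B)" "out_arcs (mat_digraph B) i \<noteq> {}" for i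
  proof -
    have "i < n" "supp i \<noteq> {}" using that by (auto simp: out_arcs_def arcs_G supp_def)
    then have "e \<in> out_arcs H i \<longleftrightarrow> e = (i, f i)" for e by (auto simp: out_arcs_def H_def)
    then show ?thesis by auto
  qed
  ultimately show "H \<in> sunflower_subgraphs (mat_digraph B)" by (auto simp: sunflower_subgraphs_def)
qed

lemma finite_sunflowers: "finite (sunflower_subgraphs (mat_digraph B))"
proof (rule finite_subset)
  show "sunflower_subgraphs (mat_digraph B)
    \<subseteq> (\<lambda>S. mat_digraph B\<lparr>arcs := S\<rparr>) ` Pow (arcs (mat_digraph B))"
  proof
    fix H assume "H \<in> sunflower_subgraphs (mat_digraph B)"
    note H = sunflowerD[OF this]
    have "H = mat_digraph B\<lparr>arcs := arcs H\<rparr>"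
      using H by (intro pre_digraph.equality) auto
    then show "H \<in> (\<lambda>S. mat_digraph B\<lparr>arcs := S\<rparr>) ` Pow (arcs (mat_digraph B))" using H(2) by blast
  qed
qed simp

abbreviation smax :: "(nat, nat \<times> nat) pre_digraph \<Rightarrow> real" where
  "smax H \<equiv> max_cycle_gmean H (mat_weight B)"

lemma sunflowers_ne: "sunflower_subgraphs (mat_digraph B) \<noteq> {}"
  by (rule ex_sunflower[of "\<lambda>i. SOME j. j \<in> supp i"]) (auto simp: some_in_eq)

lemma le_sunflower_max: "H \<in> sunflower_subgraphs (mat_digraph B) \<Longrightarrow> smax H \<le> sunflower_max B"
  unfolding sunflower_max_def using finite_sunflowers by (intro Max_ge) auto

lemma sunflower_min_le: "H \<in> sunflower_subgraphs (mat_digraph B) \<Longrightarrow> sunflower_min B \<le> smax H"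
  unfolding sunflower_min_def using finite_sunflowers by (intro Min_le) auto

lemma sunflower_max_attained:
  obtains H where "H \<in> sunflower_subgraphs (mat_digraph B)" "smax H = sunflower_max B"
proof -
  have "sunflower_max B \<in> smax ` sunflower_subgraphs (mat_digraph B)"
    unfolding sunflower_max_def using finite_sunflowers sunflowers_ne by (intro Max_in) auto
  then show ?thesis using that by force
qed

lemma sunflower_min_attained:
  obtains H where "H \<in> sunflower_subgraphs (mat_digraph B)" "smax H = sunflower_min B"
proof -
  have "sunflower_min B \<in> smax ` sunflower_subgraphs (mat_digraph B)"
    unfolding sunflower_min_def using finite_sunflowers sunflowers_ne by (intro Min_in) auto
  then show ?thesis using that by force
qed

lemma smax_nonneg:
  assumes "H \<in> sunflower_subgraphs (mat_digraph B)"
  shows "0 \<le> smax H"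
proof -
  interpret H: fin_digraph H by (rule sunflowerD(1)[OF assms])
  have "0 \<le> min_cycle_gmean H (mat_weight B)" "min_cycle_gmean H (mat_weight B) \<le> smax H"
    using H.cycle_gmean_bounds[of "mat_weight B"] sunflower_weight_pos[OF assms] by blast+
  then show ?thesis by simp
qed

lemma sunflower_min_nonneg: "0 \<le> sunflower_min B"
  using sunflower_min_attained smax_nonneg by metis

lemma sunflower_min_le_max: "sunflower_min B \<le> sunflower_max B"
  using sunflower_max_attained sunflower_min_le by metis

text \<open>Bounds the largest cycle mean from below without exhibiting a cycle: for a level
  \<open>a\<close> strictly between \<open>smax H\<close> and \<open>b\<close>, a potential on
  \<open>H\<close> exists and contradicts \<open>y\<close> on \<open>K\<close>.\<close>

lemma le_smax:
  assumes H: "H \<in> sunflower_subgraphs (mat_digraph B)" and K: "K \<noteq> {}" "K \<subseteq> {..<n}"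
    and y: "\<And>i. 0 < y i"
    "\<And>i. i \<in> K \<Longrightarrow> \<exists>j\<in>K. (i, j) \<in> arcs H \<and> b * y i \<le> B $$ (i, j) * y j"
  shows "b \<le> smax H"
proof (rule ccontr)
  interpret H: fin_digraph H by (rule sunflowerD(1)[OF H])
  assume "\<not> b \<le> smax H"
  then obtain a where a: "smax H < a" "a < b" using dense[of "smax H" b] by auto
  have a0: "0 < a" using a(1) smax_nonneg[OF H] by simp
  have w: "\<And>e. e \<in> arcs H \<Longrightarrow> 0 < mat_weight B e" by (rule sunflower_weight_pos[OF H])
  have "\<And>p. H.cycle p \<Longrightarrow> cycle_gmean (mat_weight B) p \<le> a"
    using H.cycle_gmean_le_max[of _ "mat_weight B"] a(1) by force
  then obtain x where x: "\<And>v. 0 < x v"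
    "\<And>e. e \<in> arcs H \<Longrightarrow> mat_weight B e * x (head H e) \<le> a * x (tail H e)"
    using H.ex_upper_potential[of "mat_weight B" a] w a0 by blast
  have "b \<le> a"
  proof (rule potential_compare[OF _ K(1) x(1) y(1)])
    show "finite K" using K(2) finite_subset by blast
    fix i assume "i \<in> K"
    then obtain j where j: "j \<in> K" "(i, j) \<in> arcs H" "b * y i \<le> B $$ (i, j) * y j" using y(2) by blast
    then show "\<exists>u\<in>K. \<exists>c>0. c * x u \<le> a * x i \<and> b * y i \<le> c * y u"
      using w[OF j(2)] x(2)[OF j(2)] sunflowerD(3,4)[OF H]
      by (intro bexI[of _ j] exI[of _ "B $$ (i, j)"]) auto
  qed
  then show False using a(2) by simp
qed

text \<open>A cycle of maximal mean uses one outgoing arc per node, so it extends to a sunflower by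
  arbitrary choices elsewhere.\<close>

lemma mu_le_sunflower_max: "mu B \<le> sunflower_max B"
proof (cases "has_cycle B")
  case True
  then obtain p where p: "G.cycle p" "cycle_gmean (mat_weight B) p = mu B"
    using G.max_cycle_gmean_attained[of "mat_weight B"] unfolding mu_def by blast
  obtain K x where K: "K \<noteq> {}" "K \<subseteq> verts (mat_digraph B)" "\<And>v. 0 < x v"
    "\<And>v. v \<in> K \<Longrightarrow> \<exists>e\<in>arcs (mat_digraph B). tail (mat_digraph B) e = v
      \<and> head (mat_digraph B) e \<in> K
      \<and> mat_weight B e * x (head (mat_digraph B) e) = cycle_gmean (mat_weight B) p * x v"
    using G.cycle_tight_potential[OF p(1), of "mat_weight B"] mat_weight_pos[OF B_nonneg] by blast
  have "\<exists>j\<in>K. j \<in> supp i \<and> B $$ (i, j) * x j = mu B * x i" if "i \<in> K" for i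
    using K(4)[OF that] p(2) by (auto simp: arcs_G supp_def)
  then obtain g where g: "\<And>i. i \<in> K \<Longrightarrow> g i \<in> K \<and> g i \<in> supp i \<and> B $$ (i, g i) * x (g i) = mu B * x i"
    by metis
  define f where "f i = (if i \<in> K then g i else SOME j. j \<in> supp i)" for i
  have sel: "f i \<in> supp i" if "i < n" "supp i \<noteq> {}" for i
    using g[of i] that by (simp add: f_def some_in_eq)
  obtain H where H: "H \<in> sunflower_subgraphs (mat_digraph B)"
    "arcs H = {(i, f i) | i. i < n \<and> supp i \<noteq> {}}"
    using ex_sunflower[of f, OF sel] by blast
  have "mu B \<le> smax H"
  proof (rule le_smax[OF H(1) K(1)])
    show "K \<subseteq> {..<n}" using K(2) by auto
    fix i assume i: "i \<in> K"
    then show "\<exists>j\<in>K. (i, j) \<in> arcs H \<and> mu B * x i \<le> B $$ (i, j) * x j"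
      using g[OF i] K(2) by (intro bexI[of _ "g i"]) (auto simp: H(2) f_def)
  qed (rule K(3))
  then show ?thesis using le_sunflower_max[OF H(1)] by simp
next
  case False
  then show ?thesis
    using acyclic_mu_nu[of B] sunflower_min_nonneg sunflower_min_le_max by simp
qed

lemma sunflower_max_potential:
  assumes "0 < a" "sunflower_max B \<le> a"
  obtains x where "\<And>i. 0 < x i" "\<And>i j. i < n \<Longrightarrow> j \<in> supp i \<Longrightarrow> B $$ (i, j) * x j \<le> a * x i"
proof -
  obtain x where "\<forall>i. 0 < x i" "\<forall>i<n. \<forall>j<n. B $$ (i, j) * x j \<le> a * x i"
    using mu_le_imp_potential[OF B_nonneg assms(1)] mu_le_sunflower_max assms(2) by force
  then show ?thesis using that[of x] by (auto simp: supp_def)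
qed

lemma sunflower_max_tight:
  assumes "0 < sunflower_max B"
  obtains K x where "K \<noteq> {}" "K \<subseteq> {..<n}" "\<And>i. 0 < x i"
    "\<And>i. i \<in> K \<Longrightarrow> \<exists>j\<in>K. j \<in> supp i \<and> B $$ (i, j) * x j = sunflower_max B * x i"
proof -
  obtain H where H: "H \<in> sunflower_subgraphs (mat_digraph B)" "smax H = sunflower_max B"
    by (rule sunflower_max_attained)
  interpret H: fin_digraph H by (rule sunflowerD(1)[OF H(1)])
  have "\<exists>p. H.cycle p" using assms H(2) unfolding max_cycle_gmean_def by (auto split: if_splits)
  then obtain p where p: "H.cycle p" "cycle_gmean (mat_weight B) p = sunflower_max B"
    using H.max_cycle_gmean_attained[of "mat_weight B"] H(2) by metis
  obtain K x where K: "K \<noteq> {}" "K \<subseteq> verts H" "\<And>v. 0 < x v"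
    "\<And>v. v \<in> K \<Longrightarrow> \<exists>e\<in>arcs H. tail H e = v \<and> head H e \<in> K
      \<and> mat_weight B e * x (head H e) = cycle_gmean (mat_weight B) p * x v"
    using H.cycle_tight_potential[OF p(1), of "mat_weight B"] sunflower_weight_pos[OF H(1)] by blast
  have "\<exists>j\<in>K. j \<in> supp i \<and> B $$ (i, j) * x j = sunflower_max B * x i" if i: "i \<in> K" for i
  proof -
    obtain e where e: "e \<in> arcs H" "tail H e = i" "head H e \<in> K"
      "mat_weight B e * x (head H e) = sunflower_max B * x i" using K(4)[OF i] p(2) by metis
    obtain j where j: "e = (i, j)" using e(2) sunflowerD(3)[OF H(1)] by (cases e) auto
    have "j \<in> supp i" using e(1) sunflowerD(2)[OF H(1)] unfolding j by (auto simp: arcs_G supp_def)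
    then show ?thesis using e(3,4) sunflowerD(4)[OF H(1)] unfolding j by auto
  qed
  moreover have "K \<subseteq> {..<n}" using K(2) sunflowerD(5)[OF H(1)] by auto
  ultimately show ?thesis using that K(1,3) by blast
qed

subsection \<open>Almost optimal sunflowers\<close>

text \<open>The index set on which such an \<open>x\<close> exists is grown greedily: an index with an arc into the
  set is added with a large entry, and if there is none the complement contains a final class.\<close>

lemma ex_almost_potential:
  assumes l: "0 < l" and cls: "\<And>C. C \<in> final_classes B \<Longrightarrow> nuC C < l \<or> muC C \<le> l"
  obtains x where "\<And>i. 0 < x i" "\<And>i. i < n \<Longrightarrow>
    (\<forall>j\<in>supp i. B $$ (i, j) * x j \<le> l * x i) \<or> (\<exists>j\<in>supp i. B $$ (i, j) * x j < l * x i)"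
proof -
  \<comment> \<open>Relative to \<open>W\<close>, the arcs that are relied on must end in
    \<open>W\<close>, so enlarging \<open>W\<close> without changing \<open>x\<close> on it
    preserves the property. A zero row satisfies the first alternative.\<close>
  define good where "good W x i \<longleftrightarrow> (\<forall>j\<in>supp i. j \<in> W \<and> B $$ (i, j) * x j \<le> l * x i)
    \<or> (\<exists>j\<in>supp i. j \<in> W \<and> B $$ (i, j) * x j < l * x i)" for W and x :: "nat \<Rightarrow> real" and i
  define P where "P W \<longleftrightarrow> W \<subseteq> {..<n} \<and> (\<exists>x. (\<forall>i. 0 < x i) \<and> (\<forall>i\<in>W. good W x i))" for W
  have good_mono: "good W' x' i" if "good W x i" "i \<in> W" "W \<subseteq> W'" "\<And>j. j \<in> W \<Longrightarrow> x' j = x j"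
    for W W' x x' i
    using that unfolding good_def by (metis subsetD)
  have "P {}" by (auto simp: P_def intro: exI[of _ "\<lambda>_. 1"])
  moreover have "finite {W. P W}" by (rule finite_subset[of _ "Pow {..<n}"]) (auto simp: P_def)
  ultimately obtain W where W: "P W" and max: "\<And>W'. P W' \<Longrightarrow> W \<subseteq> W' \<Longrightarrow> W' = W"
    using finite_has_maximal2[of "{W. P W}" "{}"] by auto
  obtain x where x: "\<And>i. 0 < x i" "\<And>i. i \<in> W \<Longrightarrow> good W x i" using W by (auto simp: P_def)
  have sub: "W \<subseteq> {..<n}" using W by (simp add: P_def)
  have closed: "j \<notin> W" if i: "i < n" "i \<notin> W" and j: "j \<in> supp i" for i j
  proof
    assume jW: "j \<in> W"
    \<comment> \<open>Chosen so that \<open>l * y i\<close> exceeds \<open>B $$ (i, j) * x j\<close>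
      by exactly \<open>l\<close>, which makes the arc into \<open>W\<close> strict.\<close>
    define y where "y = x(i := 1 + B $$ (i, j) * x j / l)"
    have "0 < y k" for k using x(1) l supp_pos[OF i(1) j] by (auto simp: y_def intro!: add_pos_pos)
    moreover have "good (insert i W) y k" if "k \<in> W" for k
      by (rule good_mono[OF x(2)[OF that] that]) (use i in \<open>auto simp: y_def\<close>)
    moreover have "good (insert i W) y i"
    proof -
      have "i \<noteq> j" using i jW by auto
      then have "B $$ (i, j) * y j < l * y i" using l by (simp add: y_def distrib_left)
      then show ?thesis using j jW by (auto simp: good_def)
    qed
    ultimately have "P (insert i W)" using sub i by (auto simp: P_def intro!: exI[of _ y])
    then show False using max[of "insert i W"] i by auto
  qed
  have "W = {..<n}"
  proof (rule ccontr)
    assume "W \<noteq> {..<n}"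
    then have "{..<n} - W \<noteq> {}" using sub by auto
    moreover have "supp i \<subseteq> {..<n} - W" if "i \<in> {..<n} - W" for i
      using closed[of i] that by (auto simp: supp_def)
    ultimately obtain C where C: "C \<in> final_classes B" "C \<subseteq> {..<n} - W"
      using ex_final_class_subset[of "{..<n} - W"] by blast
    \<comment> \<open>The set to be added is the whole class if its cycle means are at most
      \<open>l\<close>, and otherwise the support of a minimal cycle, whose arcs are strict since
      \<open>nuC C < l\<close>.\<close>
    have "\<exists>E y. E \<noteq> {} \<and> E \<subseteq> {..<n} - W \<and> (\<forall>i. 0 < y i) \<and> (\<forall>i\<in>E. good E y i)"
    proof (cases "muC C \<le> l")
      case True
      obtain y where y: "\<forall>i. 0 < y i" "\<forall>i\<in>C. \<forall>j\<in>C. B $$ (i, j) * y j \<le> l * y i"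
        using class_mu_le_imp_potential[OF B_nonneg final_classD(2)[OF C(1)] l True] by blast
      have "good C y i" if "i \<in> C" for i
        using y(2) that final_classD(3)[OF C(1) that] unfolding good_def by blast
      then show ?thesis using y(1) C(2) final_classD(1)[OF C(1)] by blast
    next
      case False
      then have c: "has_cycle (class_mat B C)" and "nuC C < l"
        using acyclic_mu_nu[of "class_mat B C"] l cls[OF C(1)] by auto
      obtain K y where K: "K \<noteq> {}" "K \<subseteq> C" "\<forall>i. 0 < y i"
        "\<forall>i\<in>K. \<exists>j\<in>K. B $$ (i, j) \<noteq> 0 \<and> B $$ (i, j) * y j = nuC C * y i"
        using class_nu_tight[OF B_nonneg final_classD(2)[OF C(1)] c] by blast
      have "good K y i" if i: "i \<in> K" for i
      proof -
        obtain j where j: "j \<in> K" "B $$ (i, j) \<noteq> 0" "B $$ (i, j) * y j = nuC C * y i"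
          using K(4) i by blast
        have "j \<in> supp i" using j K(2) C(2) by (auto simp: supp_def)
        moreover have "nuC C * y i < l * y i" using \<open>nuC C < l\<close> K(3) by simp
        ultimately show ?thesis using j unfolding good_def by auto
      qed
      moreover have "K \<subseteq> {..<n} - W" using K(2) C(2) by blast
      ultimately show ?thesis using K(1,3) by (intro exI[of _ K] exI[of _ y]) simp
    qed
    then obtain E y where E: "E \<noteq> {}" "E \<subseteq> {..<n} - W" "\<And>i. 0 < y i" "\<And>i. i \<in> E \<Longrightarrow> good E y i"
      by metis
    define z where "z i = (if i \<in> E then y i else x i)" for i
    have "good (W \<union> E) z i" if "i \<in> W" for i
      by (rule good_mono[OF x(2)[OF that] that]) (use E(2) in \<open>auto simp: z_def\<close>)
    moreover have "good (W \<union> E) z i" if "i \<in> E" for i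
      by (rule good_mono[OF E(4)[OF that] that]) (auto simp: z_def)
    moreover have "0 < z i" for i using x E by (simp add: z_def)
    ultimately have "P (W \<union> E)" using sub E(2) by (auto simp: P_def intro!: exI[of _ z])
    then show False using max[of "W \<union> E"] E by auto
  qed
  then show ?thesis using that[of x] x by (auto simp: good_def)
qed

text \<open>One vector \<open>x\<close> serves both claims: choosing in each nonzero row an arc that
  respects the bound gives a sunflower, while averaging gives weights for which \<open>x\<close> is
  superinvariant at level \<open>l\<close>.\<close>

lemma ex_sunflower_rho_le:
  assumes l: "0 < l" and cls: "\<And>C. C \<in> final_classes B \<Longrightarrow> nuC C < l \<or> muC C \<le> l"
  shows "sunflower_min B \<le> l" "\<exists>p\<in>row_weights. rho (wmat p) \<le> l"
proof -
  obtain x where x: "\<And>i. 0 < x i" "\<And>i. i < n \<Longrightarrow>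
    (\<forall>j\<in>supp i. B $$ (i, j) * x j \<le> l * x i) \<or> (\<exists>j\<in>supp i. B $$ (i, j) * x j < l * x i)"
    using ex_almost_potential[OF l cls] by blast
  have "\<exists>j. i < n \<and> supp i \<noteq> {} \<longrightarrow> j \<in> supp i \<and> B $$ (i, j) * x j \<le> l * x i" for i
    using x(2)[of i] by (meson ex_in_conv less_imp_le)
  then obtain f where f: "\<And>i. i < n \<Longrightarrow> supp i \<noteq> {} \<Longrightarrow>
      f i \<in> supp i \<and> B $$ (i, f i) * x (f i) \<le> l * x i" by metis
  have sel: "f i \<in> supp i" if "i < n" "supp i \<noteq> {}" for i
    using f[OF that] by blast
  obtain H where H: "H \<in> sunflower_subgraphs (mat_digraph B)"
    "arcs H = {(i, f i) | i. i < n \<and> supp i \<noteq> {}}"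
    using ex_sunflower[of f, OF sel] by blast
  interpret H: fin_digraph H by (rule sunflowerD(1)[OF H(1)])
  have "cycle_gmean (mat_weight B) p \<le> l" if "H.cycle p" for p
    using that sunflower_weight_pos[OF H(1)] x(1)
  proof (rule H.cycle_gmean_le)
    show "mat_weight B e * x (head H e) \<le> l * x (tail H e)" if "e \<in> arcs H" for e
    proof -
      obtain i where "e = (i, f i)" "i < n" "supp i \<noteq> {}" using \<open>e \<in> arcs H\<close> H(2) by blast
      then show ?thesis using f[of i] by (simp add: sunflowerD(3,4)[OF H(1)])
    qed
  qed
  then have "smax H \<le> l"
    using H.max_cycle_gmean_attained[of "mat_weight B"] l
    by (cases "\<exists>p. H.cycle p") (metis, simp add: max_cycle_gmean_def)
  then show "sunflower_min B \<le> l" using sunflower_min_le[OF H(1)] by simp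
  obtain p where p: "p \<in> row_weights"
    "\<And>i. i < n \<Longrightarrow> supp i \<noteq> {} \<Longrightarrow> (\<Sum>j\<in>supp i. p i j * (B $$ (i, j) * x j)) \<le> l * x i"
    using ex_row_weights[of "\<lambda>i j. B $$ (i, j) * x j" "\<lambda>i. l * x i"] x(2) by blast
  have "rho (wmat p) \<le> l"
  proof (rule rho_wmat_le[OF p(1) x(1)])
    show "act p x i \<le> l * x i" if "i < n" for i
      using p(2)[OF that] l x(1)[of i] by (cases "supp i = {}") (auto simp: act_def)
  qed
  then show "\<exists>p\<in>row_weights. rho (wmat p) \<le> l" using p(1) by blast
qed

subsection \<open>The set of spectral radii\<close>

lemma row_weights_ne: "row_weights \<noteq> {}"
  using ex_row_weights[of "\<lambda>_ _. 0" "\<lambda>_. 0"] by auto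

text \<open>Every sunflower, restricted to a final class, keeps its arcs inside the class; if
  \<open>nuC C > 0\<close> no row there is zero, so a lower potential of the class applies to
  it.\<close>

lemma nuC_le_sunflower_min:
  assumes C: "C \<in> final_classes B"
  shows "nuC C \<le> sunflower_min B"
proof (cases "nuC C = 0")
  case False
  then have pos: "0 < nuC C" using nuC_bounds(1)[OF C] by simp
  obtain x where x: "\<And>i. 0 < x i" "\<And>i. i \<in> C \<Longrightarrow> supp i \<noteq> {}"
    "\<And>i j. i \<in> C \<Longrightarrow> j \<in> supp i \<Longrightarrow> nuC C * x i \<le> B $$ (i, j) * x j"
    using final_class_nu_potential[OF C pos] by blast
  obtain H where H: "H \<in> sunflower_subgraphs (mat_digraph B)" "smax H = sunflower_min B"
    by (rule sunflower_min_attained)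
  have "nuC C \<le> smax H"
  proof (rule le_smax[OF H(1) final_classD(1,2)[OF C] x(1)])
    fix i assume i: "i \<in> C"
    then have "i < n" using final_classD(2)[OF C] by auto
    then obtain j where "j \<in> supp i" "(i, j) \<in> arcs H" using sunflowerD(6)[OF H(1) _ x(2)[OF i]] by blast
    then show "\<exists>j\<in>C. (i, j) \<in> arcs H \<and> nuC C * x i \<le> B $$ (i, j) * x j"
      using x(3)[OF i] final_classD(3)[OF C i] by blast
  qed
  then show ?thesis using H(2) by simp
qed (simp add: sunflower_min_nonneg)

lemma sunflower_min_eq: "sunflower_min B = Max (nuC ` final_classes B)"
proof (rule antisym)
  have fin: "finite (nuC ` final_classes B)" "nuC ` final_classes B \<noteq> {}"
    using final_classes_finite_ne by auto
  show "Max (nuC ` final_classes B) \<le> sunflower_min B"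
    using fin nuC_le_sunflower_min by auto
  obtain C where C: "C \<in> final_classes B" using final_classes_finite_ne by auto
  then have "nuC C \<le> Max (nuC ` final_classes B)" using fin by (intro Max_ge) auto
  then have nonneg: "0 \<le> Max (nuC ` final_classes B)" using nuC_bounds(1)[OF C] by simp
  show "sunflower_min B \<le> Max (nuC ` final_classes B)"
  \<comment> \<open>At the maximum itself the condition of \<open>ex_sunflower_rho_le\<close> may
    fail, for a class with \<open>nuC C\<close> equal to it and \<open>muC C\<close> larger; every
    larger \<open>l\<close> is admissible.\<close>
  proof (rule dense_ge)
    fix l assume l: "Max (nuC ` final_classes B) < l"
    then have "nuC C < l" if "C \<in> final_classes B" for C using fin that by simp
    then show "sunflower_min B \<le> l" using ex_sunflower_rho_le(1)[of l] l nonneg by simp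
  qed
qed

lemma nuC_le_rho:
  assumes C: "C \<in> final_classes B" and p: "p \<in> row_weights"
  shows "nuC C \<le> rho (wmat p)"
proof (cases "nuC C = 0")
  case False
  then have pos: "0 < nuC C" using nuC_bounds(1)[OF C] by simp
  obtain x where x: "\<And>i. 0 < x i" "\<And>i. i \<in> C \<Longrightarrow> supp i \<noteq> {}"
    "\<And>i j. i \<in> C \<Longrightarrow> j \<in> supp i \<Longrightarrow> nuC C * x i \<le> B $$ (i, j) * x j"
    using final_class_nu_potential[OF C pos] by blast
  show ?thesis
  proof (rule le_rho_wmat[OF p final_classD(1,2)[OF C] x(1)])
    fix i assume i: "i \<in> C"
    then have "i < n" using final_classD(2)[OF C] by auto
    then show "nuC C * x i \<le> act p (\<lambda>j. if j \<in> C then x j else 0) i"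
      using x(2,3)[OF i] final_classD(3)[OF C i] by (intro act_ge[OF p]) auto
  qed
qed (use rho_nonneg[OF wmat_nonneg[OF p] n_pos] in simp)

lemma rho_bounds:
  assumes p: "p \<in> row_weights"
  shows "sunflower_min B \<le> rho (wmat p)" "rho (wmat p) \<le> sunflower_max B"
proof -
  show "sunflower_min B \<le> rho (wmat p)"
    unfolding sunflower_min_eq using final_classes_finite_ne nuC_le_rho[OF _ p] by auto
  show "rho (wmat p) \<le> sunflower_max B"
  \<comment> \<open>\<open>sunflower_max B\<close> may be 0, where no potential is
    available.\<close>
  proof (rule dense_ge)
    fix l assume l: "sunflower_max B < l"
    then have l0: "0 < l" using sunflower_min_nonneg sunflower_min_le_max by simp
    obtain x where x: "\<And>i. 0 < x i" "\<And>i j. i < n \<Longrightarrow> j \<in> supp i \<Longrightarrow> B $$ (i, j) * x j \<le> l * x i"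
      using sunflower_max_potential[of l] l l0 by auto
    show "rho (wmat p) \<le> l"
    proof (rule rho_wmat_le[OF p x(1)])
      fix i assume i: "i < n"
      have "0 \<le> l * x i" using l0 x(1)[of i] by simp
      then show "act p x i \<le> l * x i" using act_le[OF p i] x(2)[OF i] by blast
    qed
  qed
qed

lemma muC_le_sunflower_max:
  assumes C: "C \<in> final_classes B"
  shows "muC C \<le> sunflower_max B"
proof (rule dense_ge)
  fix l assume l: "sunflower_max B < l"
  then have l0: "0 < l" using sunflower_min_nonneg sunflower_min_le_max by simp
  obtain x where x: "\<And>i. 0 < x i" "\<And>i j. i < n \<Longrightarrow> j \<in> supp i \<Longrightarrow> B $$ (i, j) * x j \<le> l * x i"
    using sunflower_max_potential[of l] l l0 by auto
  show "muC C \<le> l"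
  proof (rule class_mu_le[OF B_nonneg final_classD(2)[OF C] _ x(1)])
    fix i j assume "i \<in> C" "j \<in> C"
    then have ij: "i < n" "j < n" using final_classD(2)[OF C] by auto
    have "0 \<le> l * x i" using l0 x(1)[of i] by simp
    then show "B $$ (i, j) * x j \<le> l * x i"
      using x(2)[OF ij(1), of j] B_eq_0[OF ij(2), of i] by (cases "j \<in> supp i") auto
  qed (use l0 in simp)
qed

section \<open>Attainment of the upper endpoint\<close>

text \<open>Where \<open>y / x\<close> is maximal, for a subinvariant vector \<open>y\<close> of \<open>A\<close> and a potential \<open>x\<close>, all
  inequalities are equalities; the indices where this happens form a closed set.\<close>

lemma sunflower_max_in_eta_imp:
  assumes p: "p \<in> row_weights" and rho: "rho (wmat p) = sunflower_max B" and M: "0 < sunflower_max B"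
  shows "\<exists>C\<in>final_classes B. muC C = sunflower_max B \<and> nuC C = sunflower_max B"
proof -
  let ?M = "sunflower_max B"
  obtain x where x: "\<And>i. 0 < x i" "\<And>i j. i < n \<Longrightarrow> j \<in> supp i \<Longrightarrow> B $$ (i, j) * x j \<le> ?M * x i"
    using sunflower_max_potential[of ?M] M by auto
  obtain y where y: "\<And>i. 0 \<le> y i" "\<exists>i<n. 0 < y i"
    "\<And>i. i < n \<Longrightarrow> rho (wmat p) * y i \<le> (\<Sum>j<n. wmat p $$ (i, j) * y j)"
    using rho_subinvariant[OF wmat_nonneg[OF p] n_pos] by blast
  have yop: "?M * y i \<le> act p y i" if "i < n" for i using y(3)[OF that] that by (simp add: sum_wmat rho)
  define r where "r = Max ((\<lambda>i. y i / x i) ` {..<n})"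
  have r: "y j \<le> r * x j" if "j < n" for j
  proof -
    have "y j / x j \<le> r" unfolding r_def using that by (intro Max_ge) auto
    then show ?thesis using x(1)[of j] by (simp add: field_simps)
  qed
  obtain k where k: "k < n" "0 < y k" using y(2) by blast
  have r0: "0 < r" using r[OF k(1)] k(2) x(1)[of k] by (metis less_le_trans zero_less_mult_pos2)
  define D where "D = {i. i < n \<and> y i = r * x i}"
  have "r \<in> (\<lambda>i. y i / x i) ` {..<n}" unfolding r_def using n_pos by (intro Max_in) auto
  then obtain i0 where "i0 < n" "r = y i0 / x i0" by auto
  then have ne: "D \<noteq> {}" using x(1)[of i0] by (auto simp: D_def)
  \<comment> \<open>The chain \<open>?M * y i\<close> \<le> \<open>act p y i\<close> \<le>
    \<open>r * ?M * x i\<close> = \<open>?M * y i\<close> collapses, so each arc out of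
    \<open>i\<close> is tight for \<open>x\<close> and leads to another index with
    \<open>y = r * x\<close>.\<close>
  have step: "supp i \<noteq> {} \<and> (\<forall>j\<in>supp i. j \<in> D \<and> B $$ (i, j) * x j = ?M * x i)" if "i \<in> D" for i
  proof -
    have i: "i < n" "y i = r * x i" using that by (auto simp: D_def)
    have pos: "0 < ?M * y i" using M r0 x(1)[of i] i by simp
    have sup: "supp i \<noteq> {}" using yop[OF i(1)] pos by (auto simp: act_def)
    have upper: "B $$ (i, j) * (r * x j) \<le> ?M * y i" if "j \<in> supp i" for j
    proof -
      have "B $$ (i, j) * (r * x j) = r * (B $$ (i, j) * x j)" by simp
      also have "\<dots> \<le> r * (?M * x i)" using x(2)[OF i(1) that] r0 by (intro mult_left_mono) auto
      finally show ?thesis using i by (simp add: mult_ac)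
    qed
    have yr: "B $$ (i, j) * y j \<le> B $$ (i, j) * (r * x j)" if "j \<in> supp i" for j
      using r[of j] supp_pos[OF i(1) that] that by (intro mult_left_mono) (auto simp: supp_def)
    have le: "B $$ (i, j) * y j \<le> ?M * y i" if "j \<in> supp i" for j
      using upper[OF that] yr[OF that] by simp
    have "act p y i \<le> ?M * y i" using act_le[OF p i(1), of "?M * y i" y] pos le by simp
    then have eq: "act p y i = ?M * y i" using yop[OF i(1)] by simp
    have "j \<in> D \<and> B $$ (i, j) * x j = ?M * x i" if j: "j \<in> supp i" for j
    proof -
      have 1: "B $$ (i, j) * y j = ?M * y i" using act_eq_imp_eq[OF p i(1) sup j _ eq] le by blast
      then have 2: "B $$ (i, j) * (r * x j) = B $$ (i, j) * y j"
        using upper[OF j] yr[OF j] by linarith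
      then have 3: "y j = r * x j" using supp_pos[OF i(1) j]
        by (metis less_irrefl mult_left_cancel)
      have "r * (B $$ (i, j) * x j) = r * (?M * x i)" using 1 2 i(2) by (simp add: mult_ac)
      then have "B $$ (i, j) * x j = ?M * x i" using r0 by simp
      then show ?thesis using 3 j by (auto simp: D_def supp_def)
    qed
    then show ?thesis using sup by blast
  qed
  have "supp i \<subseteq> D" if "i \<in> D" for i using step[OF that] by blast
  moreover have "D \<subseteq> {..<n}" by (auto simp: D_def)
  ultimately obtain C where C: "C \<in> final_classes B" "C \<subseteq> D"
    using ex_final_class_subset[OF ne] by blast
  have "has_cycle (class_mat B C)" using final_class_cases[OF C(1)] step C(2) by blast
  then have "?M \<le> nuC C"
  proof (rule le_class_nu[OF B_nonneg final_classD(2)[OF C(1)] _ x(1)])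
    fix i j assume "i \<in> C" "j \<in> C" "B $$ (i, j) \<noteq> 0"
    moreover then have "j \<in> supp i" using final_classD(2)[OF C(1)] by (auto simp: supp_def)
    ultimately show "?M * x i \<le> B $$ (i, j) * x j" using step C(2) by force
  qed
  then show ?thesis using nuC_bounds(2)[OF C(1)] muC_le_sunflower_max[OF C(1)] C(1) by force
qed

text \<open>A final class with \<open>nuC C\<close> equal to the maximum squeezes
  \<open>rho (wmat p)\<close> between equal bounds for every \<open>p\<close>. In the converse, if
  the maximum is 0 then every final class satisfies the condition.\<close>

lemma sunflower_max_in_eta_iff:
  "sunflower_max B \<in> eta B \<longleftrightarrow>
    (\<exists>C\<in>final_classes B. muC C = sunflower_max B \<and> nuC C = sunflower_max B)"
proof
  assume "\<exists>C\<in>final_classes B. muC C = sunflower_max B \<and> nuC C = sunflower_max B"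
  then obtain C where C: "C \<in> final_classes B" "nuC C = sunflower_max B" by blast
  obtain p where p: "p \<in> row_weights" using row_weights_ne by blast
  have "rho (wmat p) = sunflower_max B" using nuC_le_rho[OF C(1) p] C(2) rho_bounds(2)[OF p] by simp
  then show "sunflower_max B \<in> eta B" unfolding eta_eq using p by (metis imageI)
next
  assume "sunflower_max B \<in> eta B"
  then obtain p where p: "p \<in> row_weights" "rho (wmat p) = sunflower_max B" by (auto simp: eta_eq)
  show "\<exists>C\<in>final_classes B. muC C = sunflower_max B \<and> nuC C = sunflower_max B"
  proof (cases "sunflower_max B = 0")
    case True
    obtain C where C: "C \<in> final_classes B" using final_classes_finite_ne by auto
    then show ?thesis using nuC_bounds[OF C] muC_le_sunflower_max[OF C] True by force
  next
    case False
    then have "0 < sunflower_max B" using sunflower_min_nonneg sunflower_min_le_max by simp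
    then show ?thesis using sunflower_max_in_eta_imp p by blast
  qed
qed

section \<open>Attainment of the lower endpoint\<close>

lemma act_mono:
  assumes p: "p \<in> row_weights" and i: "i < n" and le: "\<And>j. x j \<le> y j"
  shows "act p x i \<le> act p y i"
  unfolding act_def using le row_weightsD(1)[OF p i] supp_pos[OF i]
  by (intro sum_mono mult_left_mono) (auto simp: less_imp_le)

lemma act_strict_mono:
  assumes p: "p \<in> row_weights" and i: "i < n" and le: "\<And>j. x j \<le> y j"
    and j: "j \<in> supp i" "x j < y j"
  shows "act p x i < act p y i"
  unfolding act_def
proof (rule sum_strict_mono_ex1)
  show "\<forall>j\<in>supp i. p i j * (B $$ (i, j) * x j) \<le> p i j * (B $$ (i, j) * y j)"
    using le row_weightsD(1)[OF p i] supp_pos[OF i]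
    by (intro ballI mult_left_mono) (auto simp: less_imp_le)
  show "\<exists>j\<in>supp i. p i j * (B $$ (i, j) * x j) < p i j * (B $$ (i, j) * y j)"
    using j row_weightsD(1)[OF p i j(1)] supp_pos[OF i j(1)] by (intro bexI[of _ j]) auto
qed simp

text \<open>Among the vectors with \<open>A x \<ge> l x\<close> on \<open>C\<close> take one with the most strict inequalities; by
  strong connectedness a slight increase at a strict index would produce one more.\<close>

lemma less_rho_if_strict:
  assumes C: "C \<in> final_classes B" and p: "p \<in> row_weights" and l: "0 < l"
    and x: "\<And>i. 0 < x i" "\<And>i. i \<in> C \<Longrightarrow> l * x i \<le> act p x i" "\<exists>i\<in>C. l * x i < act p x i"
  shows "l < rho (wmat p)"
proof -
  have sub: "C \<subseteq> {..<n}" by (rule final_classD(2)[OF C])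
  have fin: "finite C" using sub finite_subset by blast
  define S where "S y = {i \<in> C. l * y i < act p y i}" for y
  define Q where "Q y \<longleftrightarrow> (\<forall>i. 0 < y i) \<and> (\<forall>i\<in>C. l * y i \<le> act p y i) \<and> S y \<noteq> {}" for y
  have "Q x" using x by (auto simp: Q_def S_def)
  moreover have "card (S y) < Suc (card C)" for y
    using card_mono[OF fin, of "S y"] by (auto simp: S_def)
  ultimately obtain y where y: "Q y" and max: "\<And>z. Q z \<Longrightarrow> card (S z) \<le> card (S y)"
    using ex_has_greatest_nat[of Q x "\<lambda>y. card (S y)" "Suc (card C)"] by blast
  have ypos: "\<And>i. 0 < y i" and yle: "\<And>i. i \<in> C \<Longrightarrow> l * y i \<le> act p y i" and Sy: "S y \<noteq> {}"
    using y by (auto simp: Q_def)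
  have SC: "S y = C"
  proof (rule ccontr)
    assume "S y \<noteq> C"
    then have "C - S y \<noteq> {}" "C - S y \<noteq> C" using Sy by (auto simp: S_def)
    \<comment> \<open>By minimality of \<open>C\<close> the nonstrict indices do not form a closed
      set, so some arc leads from a nonstrict index to a strict one.\<close>
    then obtain i j where i: "i \<in> C" "i \<notin> S y" and j: "j \<in> supp i" "j \<notin> C - S y"
      using final_classD(4)[OF C, of "C - S y"] by blast
    have jS: "j \<in> S y" using j final_classD(3)[OF C i(1)] by blast
    \<comment> \<open>The midpoint leaves index \<open>j\<close> strict, while the increase makes
      the row of \<open>i\<close> strict as well.\<close>
    define z where "z = y(j := (y j + act p y j / l) / 2)"
    have jl: "y j < act p y j / l" using jS l by (simp add: S_def field_simps)
    have zy: "y k \<le> z k" for k using jl by (simp add: z_def)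
    have zj: "y j < z j" using jl by (simp add: z_def)
    have zj2: "l * z j < act p y j" using jl l by (simp add: z_def field_simps)
    have cn: "k < n" if "k \<in> C" for k using sub that by auto
    have opz: "act p y k \<le> act p z k" if "k \<in> C" for k using act_mono[OF p cn[OF that] zy] .
    have zne: "z k = y k" if "k \<noteq> j" for k using that by (simp add: z_def)
    have zS: "k \<in> S z" if "k \<in> S y" for k
    proof (cases "k = j")
      case True
      then show ?thesis using zj2 opz[of j] jS by (auto simp: S_def)
    next
      case False
      then show ?thesis using that opz[of k] zne[OF False] by (auto simp: S_def)
    qed
    have "i \<noteq> j" using i(2) jS by auto
    have "act p y i < act p z i" using act_strict_mono[of p i y z j] p cn[OF i(1)] zy j(1) zj by blast
    then have iS: "i \<in> S z" using i(1) yle[OF i(1)] zne[OF \<open>i \<noteq> j\<close>] by (simp add: S_def)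
    have "l * z k \<le> act p z k" if "k \<in> C" for k
    proof (cases "k = j")
      case True
      then show ?thesis using zS[OF jS] by (simp add: S_def)
    next
      case False
      then show ?thesis using yle[OF that] opz[OF that] zne[OF False] by simp
    qed
    moreover have "0 < z k" for k using zy[of k] ypos[of k] by simp
    ultimately have "Q z" using iS by (auto simp: Q_def)
    moreover have "insert i (S y) \<subseteq> S z" "finite (S z)" using zS iS fin by (auto simp: S_def)
    then have "card (insert i (S y)) \<le> card (S z)" by (intro card_mono)
    moreover have "finite (S y)" using fin by (simp add: S_def)
    ultimately show False using max[of z] i(2) by simp
  qed
  show ?thesis
  proof (rule less_rho_wmat[OF p final_classD(1)[OF C] sub ypos])
    fix i assume i: "i \<in> C"
    have "act p (\<lambda>j. if j \<in> C then y j else 0) i = act p y i"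
      unfolding act_def using final_classD(3)[OF C i] by (intro sum.cong) auto
    then show "l * y i < act p (\<lambda>j. if j \<in> C then y j else 0) i" using SC i by (auto simp: S_def)
  qed
qed

text \<open>The condition is what \<open>ex_sunflower_rho_le\<close> requires at the level
  \<open>sunflower_min B\<close> itself. Conversely, if the minimum is attained, a lower potential
  of a class realizing it admits no strict row, so all arcs of the class are tight and its cycle
  means coincide.\<close>

lemma sunflower_min_in_eta_iff:
  assumes m: "0 < sunflower_min B"
  shows "sunflower_min B \<in> eta B \<longleftrightarrow>
    (\<forall>C\<in>final_classes B. nuC C = sunflower_min B \<longrightarrow> muC C = sunflower_min B)"
proof
  assume all: "\<forall>C\<in>final_classes B. nuC C = sunflower_min B \<longrightarrow> muC C = sunflower_min B"
  have "nuC C < sunflower_min B \<or> muC C \<le> sunflower_min B" if "C \<in> final_classes B" for C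
    using nuC_le_sunflower_min[OF that] all that by force
  then obtain p where "p \<in> row_weights" "rho (wmat p) \<le> sunflower_min B"
    using ex_sunflower_rho_le(2)[OF m] by blast
  then show "sunflower_min B \<in> eta B" unfolding eta_eq using rho_bounds(1)[of p] by force
next
  assume "sunflower_min B \<in> eta B"
  then obtain p where p: "p \<in> row_weights" "rho (wmat p) = sunflower_min B" by (auto simp: eta_eq)
  show "\<forall>C\<in>final_classes B. nuC C = sunflower_min B \<longrightarrow> muC C = sunflower_min B"
  proof (intro ballI impI)
    fix C assume C: "C \<in> final_classes B" "nuC C = sunflower_min B"
    obtain x where x: "\<And>i. 0 < x i" "\<And>i. i \<in> C \<Longrightarrow> supp i \<noteq> {}"
      "\<And>i j. i \<in> C \<Longrightarrow> j \<in> supp i \<Longrightarrow> nuC C * x i \<le> B $$ (i, j) * x j"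
      using final_class_nu_potential[OF C(1)] C(2) m by auto
    have cn: "k < n" if "k \<in> C" for k using final_classD(2)[OF C(1)] that by auto
    have ge: "sunflower_min B * x i \<le> act p x i" if "i \<in> C" for i
      using x(3)[OF that] C(2) by (intro act_ge[OF p(1) cn[OF that] x(2)[OF that]]) auto
    have "\<not> (\<exists>i\<in>C. sunflower_min B * x i < act p x i)"
      using less_rho_if_strict[OF C(1) p(1) m x(1) ge] p(2) by auto
    then have eq: "act p x i = sunflower_min B * x i" if "i \<in> C" for i
      using ge[OF that] that by force
    have "muC C \<le> sunflower_min B"
    proof (rule class_mu_le[OF B_nonneg final_classD(2)[OF C(1)] _ x(1)])
      fix i j assume i: "i \<in> C" "j \<in> C"
      show "B $$ (i, j) * x j \<le> sunflower_min B * x i"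
      proof (cases "j \<in> supp i")
        case True
        have "B $$ (i, j) * x j = sunflower_min B * x i"
          using act_eq_imp_eq[OF p(1) cn[OF i(1)] x(2)[OF i(1)] True _ eq[OF i(1)]]
            x(3)[OF i(1)] C(2) by auto
        then show ?thesis by simp
      next
        case False
        have "0 \<le> sunflower_min B * x i" using m x(1)[of i] by simp
        then show ?thesis using B_eq_0[OF cn[OF i(2)] False] by simp
      qed
    qed (use m in simp)
    then show "muC C = sunflower_min B" using nuC_bounds(2)[OF C(1)] C(2) by simp
  qed
qed

section \<open>Cycles and the value zero\<close>

text \<open>Every arc has positive weight under \<open>p\<close>, so each row of a set with
  successors inside itself acts strictly positively, which is the strict lower bound at level
  0.\<close>

lemma rho_pos_if_has_cycle:
  assumes p: "p \<in> row_weights" and c: "has_cycle B"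
  shows "0 < rho (wmat p)"
proof -
  obtain K x where K: "K \<noteq> {}" "K \<subseteq> {..<n}" "\<forall>i. 0 < x i"
    "\<forall>i\<in>K. \<exists>j\<in>K. B $$ (i, j) \<noteq> 0 \<and> B $$ (i, j) * x j = nu B * x i"
    using nu_tight[OF B_nonneg c] by blast
  show ?thesis
  proof (rule less_rho_wmat[OF p K(1,2), of x])
    show "0 < x i" for i using K(3) by simp
    fix i assume i: "i \<in> K"
    then obtain j where "j \<in> K" "B $$ (i, j) \<noteq> 0" using K(4) by blast
    then have j: "j \<in> K" "j \<in> supp i" using K(2) by (auto simp: supp_def)
    have "i < n" using i K(2) by auto
    then have "act p (\<lambda>_. 0) i < act p (\<lambda>j. if j \<in> K then x j else 0) i"
      using j K(3) by (intro act_strict_mono[OF p _ _ j(2)]) (auto simp: less_imp_le)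
    then show "0 * x i < act p (\<lambda>j. if j \<in> K then x j else 0) i" by (simp add: act_def)
  qed
qed

lemma sunflower_max_eq_0_if_acyclic:
  assumes "\<not> has_cycle B"
  shows "sunflower_max B = 0"
proof (rule ccontr)
  assume "sunflower_max B \<noteq> 0"
  then have "0 < sunflower_max B" using sunflower_min_nonneg sunflower_min_le_max by simp
  then obtain K x where K: "K \<noteq> {}" "K \<subseteq> {..<n}" "\<And>i. 0 < x i"
    "\<And>i. i \<in> K \<Longrightarrow> \<exists>j\<in>K. j \<in> supp i \<and> B $$ (i, j) * x j = sunflower_max B * x i"
    using sunflower_max_tight by blast
  have "has_cycle B"
    by (rule has_cycleI[OF B_nonneg K(1,2)]) (use K(4) in \<open>force simp: supp_def\<close>)
  then show False using assms by blast
qed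

section \<open>Continuity and intermediate values\<close>

text \<open>A subinvariant vector of \<open>wmat p\<close> at level \<open>rho (wmat p)\<close> is
  one of \<open>wmat q\<close> at that level divided by \<open>k\<close>.\<close>

lemma rho_wmat_le_mult:
  assumes p: "p \<in> row_weights" and q: "q \<in> row_weights" and k: "0 < k"
    and le: "\<And>i j. i < n \<Longrightarrow> j \<in> supp i \<Longrightarrow> p i j \<le> k * q i j"
  shows "rho (wmat p) \<le> k * rho (wmat q)"
proof -
  obtain y where y: "\<And>i. 0 \<le> y i" "\<exists>i<n. 0 < y i"
    "\<And>i. i < n \<Longrightarrow> rho (wmat p) * y i \<le> (\<Sum>j<n. wmat p $$ (i, j) * y j)"
    using rho_subinvariant[OF wmat_nonneg[OF p] n_pos] by blast
  then obtain i0 where i0: "i0 < n" "0 < y i0" by blast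
  have "rho (wmat p) / k \<le> rho (wmat q)"
  proof (rule rho_ge[OF wmat_nonneg[OF q] n_pos, where w = y, OF y(1) i0])
    fix i assume i: "i < n"
    have "rho (wmat p) * y i \<le> act p y i" using y(3)[OF i] by (simp add: sum_wmat[OF i])
    also have "\<dots> \<le> (\<Sum>j\<in>supp i. k * q i j * (B $$ (i, j) * y j))"
      unfolding act_def using le[OF i] supp_pos[OF i] y(1)
      by (intro sum_mono mult_right_mono) (auto simp: less_imp_le)
    also have "\<dots> = k * act q y i" by (simp add: act_def sum_distrib_left mult_ac)
    finally show "rho (wmat p) / k * y i \<le> (\<Sum>j<n. wmat q $$ (i, j) * y j)"
      unfolding sum_wmat[OF i] using k by (simp add: field_simps)
  qed
  then show ?thesis using k by (simp add: field_simps)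
qed

lemma row_weights_lower_bound:
  assumes p: "p \<in> row_weights"
  obtains d where "0 < d" "\<And>i j. i < n \<Longrightarrow> j \<in> supp i \<Longrightarrow> d \<le> p i j"
proof -
  \<comment> \<open>The added 1 keeps the minimum defined when \<open>B\<close> has no arcs.\<close>
  define T where "T = insert 1 ((\<lambda>(i, j). p i j) ` (SIGMA i:{..<n}. supp i))"
  have fin: "finite T" by (simp add: T_def)
  have "Min T \<in> T" unfolding T_def by (intro Min_in) auto
  then have "0 < Min T" using row_weightsD(1)[OF p] unfolding T_def by auto
  moreover have "Min T \<le> p i j" if "i < n" "j \<in> supp i" for i j
    using that by (intro Min_le[OF fin]) (force simp: T_def)
  ultimately show ?thesis using that by blast
qed

lemma row_weights_le_1:
  assumes p: "p \<in> row_weights" and i: "i < n" "j \<in> supp i"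
  shows "p i j \<le> 1"
proof -
  have "p i j \<le> sum (p i) (supp i)"
    using row_weightsD(1)[OF p i(1)] i(2) by (intro member_le_sum) (auto simp: less_imp_le)
  also have "\<dots> = 1" using row_weightsD(2)[OF p i(1)] i(2) by blast
  finally show ?thesis .
qed

text \<open>Along the segment the weights at two parameters are comparable up to a factor
  \<open>1 + O(\<bar>t - s\<bar>)\<close>, which makes the spectral radius Lipschitz continuous.\<close>

lemma eta_intermediate:
  assumes p: "p \<in> row_weights" and q: "q \<in> row_weights"
    and r: "rho (wmat p) \<le> r" "r \<le> rho (wmat q)"
  shows "r \<in> eta B"
proof -
  define P where "P t = (\<lambda>i j. (1 - t) * p i j + t * q i j)" for t :: real
  have P: "P t \<in> row_weights" if t: "0 \<le> t" "t \<le> 1" for t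
    unfolding row_weights_def
  proof (intro CollectI allI impI conjI ballI)
    fix i assume i: "i < n"
    show "0 < P t i j" if "j \<in> supp i" for j
    proof (cases "t = 0")
      case False
      then show ?thesis
        using t row_weightsD(1)[OF p i that] row_weightsD(1)[OF q i that]
        by (auto simp: P_def intro!: add_nonneg_pos)
    qed (use row_weightsD(1)[OF p i that] in \<open>simp add: P_def\<close>)
    show "sum (P t i) (supp i) = 1" if "supp i \<noteq> {}"
      using row_weightsD(2)[OF p i that] row_weightsD(2)[OF q i that]
      by (simp add: P_def sum.distrib flip: sum_distrib_left)
  qed
  obtain dp where dp: "0 < dp" "\<And>i j. i < n \<Longrightarrow> j \<in> supp i \<Longrightarrow> dp \<le> p i j"
    using row_weights_lower_bound[OF p] by blast
  obtain dq where dq: "0 < dq" "\<And>i j. i < n \<Longrightarrow> j \<in> supp i \<Longrightarrow> dq \<le> q i j"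
    using row_weights_lower_bound[OF q] by blast
  define d where "d = min dp dq"
  have d: "0 < d" using dp dq by (simp add: d_def)
  have Pd: "d \<le> P t i j" if t: "0 \<le> t" "t \<le> 1" and ij: "i < n" "j \<in> supp i" for t i j
  proof -
    have "d = (1 - t) * d + t * d" by (simp add: algebra_simps)
    also have "\<dots> \<le> (1 - t) * p i j + t * q i j"
      using t dp(2)[OF ij] dq(2)[OF ij] by (intro add_mono mult_left_mono) (auto simp: d_def)
    finally show ?thesis by (simp add: P_def)
  qed
  define f where "f t = rho (wmat (P t))" for t
  \<comment> \<open>Weights on the segment are at least \<open>d\<close> and change by at most
    \<bar>\<open>t - s\<close>\<bar>, so their ratio is at most 1 + \<bar>\<open>t - s\<close>\<bar>
    / \<open>d\<close>; \<open>sunflower_max B\<close> bounds the radius that this factor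
    multiplies.\<close>
  define L where "L = sunflower_max B / d"
  have L: "0 \<le> L" using d sunflower_min_nonneg sunflower_min_le_max by (simp add: L_def)
  have lip: "f t - f s \<le> L * \<bar>t - s\<bar>" if t: "0 \<le> t" "t \<le> 1" and s: "0 \<le> s" "s \<le> 1" for s t
  proof -
    have "f t \<le> (1 + \<bar>t - s\<bar> / d) * f s"
      unfolding f_def
    proof (rule rho_wmat_le_mult[OF P[OF t] P[OF s]])
      show "0 < 1 + \<bar>t - s\<bar> / d" using d by (simp add: add_pos_nonneg)
      fix i j assume ij: "i < n" "j \<in> supp i"
      have "\<bar>q i j - p i j\<bar> \<le> 1"
        using row_weights_le_1[OF p ij] row_weights_le_1[OF q ij]
          row_weightsD(1)[OF p ij] row_weightsD(1)[OF q ij] by linarith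
      then have "\<bar>t - s\<bar> * \<bar>q i j - p i j\<bar> \<le> \<bar>t - s\<bar> * 1" by (intro mult_left_mono) auto
      moreover have "P t i j - P s i j = (t - s) * (q i j - p i j)" by (simp add: P_def algebra_simps)
      ultimately have "P t i j - P s i j \<le> \<bar>t - s\<bar>"
        by (metis abs_ge_self abs_mult mult.right_neutral order_trans)
      also have "\<bar>t - s\<bar> = \<bar>t - s\<bar> / d * d" using d by simp
      also have "\<dots> \<le> \<bar>t - s\<bar> / d * P s i j" using Pd[OF s ij] d by (intro mult_left_mono) auto
      finally show "P t i j \<le> (1 + \<bar>t - s\<bar> / d) * P s i j" by (simp add: algebra_simps)
    qed
    then have "f t - f s \<le> \<bar>t - s\<bar> / d * f s" by (simp add: algebra_simps)
    also have "\<dots> \<le> \<bar>t - s\<bar> / d * sunflower_max B"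
      using rho_bounds(2)[OF P[OF s]] d by (intro mult_left_mono) (auto simp: f_def)
    finally show ?thesis by (simp add: L_def mult_ac)
  qed
  have "continuous_on {0..1} f"
    unfolding continuous_on_def tendsto_iff eventually_at
  proof (intro ballI allI impI)
    fix s e :: real assume s: "s \<in> {0..1}" and e: "0 < e"
    show "\<exists>h>0. \<forall>t\<in>{0..1}. t \<noteq> s \<and> dist t s < h \<longrightarrow> dist (f t) (f s) < e"
    proof (intro exI conjI ballI impI)
      \<comment> \<open>\<open>L + 1\<close> is used because \<open>L\<close> is 0 when
        \<open>sunflower_max B\<close> is.\<close>
      show "0 < e / (L + 1)" using e L by simp
      fix t assume t: "t \<in> {0..1}" "t \<noteq> s \<and> dist t s < e / (L + 1)"
      have "\<bar>f t - f s\<bar> \<le> L * \<bar>t - s\<bar>"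
        using lip[of t s] lip[of s t] s t by (simp add: abs_le_iff abs_minus_commute)
      also have "\<dots> \<le> (L + 1) * \<bar>t - s\<bar>" by (intro mult_right_mono) auto
      also have "\<dots> < e" using t(2) L by (simp add: dist_real_def field_simps)
      finally show "dist (f t) (f s) < e" by (simp add: dist_real_def)
    qed
  qed
  moreover have "P 0 = p" "P 1 = q" by (auto simp: P_def)
  ultimately obtain t where "0 \<le> t" "t \<le> 1" "f t = r"
    using IVT'[of f 0 r 1] r by (auto simp: f_def)
  then show ?thesis using P[of t] unfolding eta_eq f_def by blast
qed

text \<open>On the set that is tight at the maximum, each row has an arc inside the set that
  strictly exceeds level \<open>r\<close>. Concentrating the weights on these arcs keeps the
  averages at least \<open>r * x i\<close>.\<close>

lemma ex_le_rho:
  assumes r: "0 \<le> r" "r < sunflower_max B"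
  shows "\<exists>p\<in>row_weights. r \<le> rho (wmat p)"
proof -
  obtain K x where K: "K \<noteq> {}" "K \<subseteq> {..<n}" "\<And>i. 0 < x i"
    "\<And>i. i \<in> K \<Longrightarrow> \<exists>j\<in>K. j \<in> supp i \<and> B $$ (i, j) * x j = sunflower_max B * x i"
    using sunflower_max_tight r by (metis le_less_trans)
  define w where "w j = (if j \<in> K then x j else 0)" for j
  have w0: "0 \<le> w j" for j using K(3)[of j] by (simp add: w_def)
  \<comment> \<open>The sign is reversed because \<open>ex_row_weights\<close> bounds averages from
    above. Rows outside \<open>K\<close> get the harmless bound 0.\<close>
  define g where "g i j = - (B $$ (i, j) * w j)" for i j
  define c where "c i = (if i \<in> K then - (r * x i) else 0)" for i
  have "(\<forall>j\<in>supp i. g i j \<le> c i) \<or> (\<exists>j\<in>supp i. g i j < c i)" if i: "i < n" for i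
  proof (cases "i \<in> K")
    case True
    then obtain j where j: "j \<in> K" "j \<in> supp i" "B $$ (i, j) * x j = sunflower_max B * x i"
      using K(4) by blast
    have "r * x i < sunflower_max B * x i" using r(2) K(3) by simp
    then have "g i j < c i" using True j by (simp add: g_def c_def w_def)
    then show ?thesis using j by blast
  next
    case False
    have "g i j \<le> c i" if "j \<in> supp i" for j
      using supp_pos[OF i that] w0[of j] False by (simp add: g_def c_def)
    then show ?thesis by blast
  qed
  then obtain p where p: "p \<in> row_weights"
    "\<And>i. i < n \<Longrightarrow> supp i \<noteq> {} \<Longrightarrow> (\<Sum>j\<in>supp i. p i j * g i j) \<le> c i"
    using ex_row_weights[of g c] by blast
  have "r \<le> rho (wmat p)"
  proof (rule le_rho_wmat[OF p(1) K(1,2), of x])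
    fix i assume i: "i \<in> K"
    have "i < n" "supp i \<noteq> {}" using i K(2,4) by blast+
    then have "(\<Sum>j\<in>supp i. p i j * g i j) \<le> - (r * x i)" using p(2)[of i] i by (simp add: c_def)
    moreover have "(\<Sum>j\<in>supp i. p i j * g i j) = - act p w i" by (simp add: g_def act_def sum_negf)
    ultimately show "r * x i \<le> act p (\<lambda>j. if j \<in> K then x j else 0) i" by (simp add: w_def[abs_def])
  qed (rule K(3))
  then show ?thesis using p(1) by blast
qed

lemma open_interval_subset_eta: "{sunflower_min B<..<sunflower_max B} \<subseteq> eta B"
proof
  fix r assume r: "r \<in> {sunflower_min B<..<sunflower_max B}"
  then have r0: "0 < r" using sunflower_min_nonneg by simp
  have "nuC C < r" if "C \<in> final_classes B" for C using nuC_le_sunflower_min[OF that] r by simp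
  then obtain p where p: "p \<in> row_weights" "rho (wmat p) \<le> r"
    using ex_sunflower_rho_le(2)[OF r0] by blast
  obtain q where q: "q \<in> row_weights" "r \<le> rho (wmat q)" using ex_le_rho[of r] r r0 by auto
  show "r \<in> eta B" using eta_intermediate[OF p(1) q(1) p(2) q(2)] .
qed

lemma eta_subset: "eta B \<subseteq> {sunflower_min B..sunflower_max B}"
  using rho_bounds by (auto simp: eta_eq)

lemma eta_ne: "eta B \<noteq> {}"
  using row_weights_ne by (auto simp: eta_eq)

lemma zero_in_eta_iff: "0 \<in> eta B \<longleftrightarrow> \<not> has_cycle B"
proof
  show "\<not> has_cycle B" if "0 \<in> eta B"
    using that rho_pos_if_has_cycle unfolding eta_eq by force
  assume "\<not> has_cycle B"
  then have "sunflower_max B = 0" by (rule sunflower_max_eq_0_if_acyclic)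
  then have "eta B \<subseteq> {0}" using eta_subset sunflower_min_nonneg by force
  then show "0 \<in> eta B" using eta_ne by auto
qed

end

theorem theorem3p7:
  fixes B :: "real mat" and n :: nat
  assumes "0 < n" and "B \<in> nonneg_mats n" and "row_uniform B"
  shows "let M = sunflower_max B; m = sunflower_min B;
             v = Max ((\<lambda>C. nu (class_mat B C)) ` final_classes B)
    in
      m = v \<and>
      eta B \<subseteq> {m..M} \<and>
      (M \<in> eta B \<longleftrightarrow>
        (\<exists>C \<in> final_classes B. mu (class_mat B C) = M \<and> nu (class_mat B C) = M)) \<and>
      (m > 0 \<longrightarrow>
        (m \<in> eta B \<longleftrightarrow>
          (\<forall>C \<in> final_classes B. \<not> trivial_class B C \<longrightarrow> nu (class_mat B C) = v \<longrightarrow>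
            mu (class_mat B C) = m \<and> nu (class_mat B C) = m))) \<and>
      (m = 0 \<longrightarrow>
        (m \<in> eta B \<longleftrightarrow> (\<nexists>p. pre_digraph.cycle (mat_digraph B) p)) \<and>
        ((\<nexists>p. pre_digraph.cycle (mat_digraph B) p) \<longrightarrow> eta B = {0})) \<and>
      (M = m \<longrightarrow> eta B = {m}) \<and>
      (M > m \<longrightarrow> {m<..<M} \<subseteq> eta B)"
proof -
  interpret row_uniform_matrix B n using assms by unfold_locales
  have "sunflower_min B \<in> eta B \<longleftrightarrow> (\<forall>C\<in>final_classes B. \<not> trivial_class B C \<longrightarrow>
      nuC C = sunflower_min B \<longrightarrow> muC C = sunflower_min B \<and> nuC C = sunflower_min B)"
    if "0 < sunflower_min B"
    unfolding sunflower_min_in_eta_iff[OF that] using trivial_class_nu that by force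
  moreover have single: "eta B = {sunflower_min B}" if "sunflower_max B = sunflower_min B"
  proof -
    have "eta B \<subseteq> {sunflower_min B}" using eta_subset that by auto
    then show ?thesis using eta_ne by blast
  qed
  moreover have "eta B = {0}" if "\<not> has_cycle B"
  proof -
    have "sunflower_max B = 0" by (rule sunflower_max_eq_0_if_acyclic[OF that])
    then have "sunflower_min B = 0" using sunflower_min_nonneg sunflower_min_le_max by simp
    then show ?thesis using single \<open>sunflower_max B = 0\<close> by simp
  qed
  ultimately show ?thesis
    unfolding Let_def sunflower_min_eq[symmetric]
    using eta_subset sunflower_max_in_eta_iff zero_in_eta_iff open_interval_subset_eta by auto
qed

end
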